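(* Let $K$ be a spherically complete $p$-adic field. Let $F\in\Phi^{(0,\infty)}$ be dominant and assume that its principal symbol is $\sigma(F)=t^m\,b(t)\,\eta^{ord(F)}$, where $m\ge0$ and $b(t)\in\mathcal A_t(1)$ is invertible in $\mathcal A_t(1)$. Then, for all $G\in\Phi^{(0,\infty)}$ there exist unique $Q\in\Phi^{(0,\infty)}$ and $R_0,\dots,R_{m-1}\in\mathcal A(\omega)[\eta]$ such that $$G=Q\cdot F+t^{m-1}R_{m-1}+\dots+R_0.$$ The remainder $t^{m-1}R_{m-1}+\dots+R_0$ can also be written in a unique way in the form $S_{m-1}\,t^{m-1}+\dots+S_0$ (products taken in $\Phi^{(0,\infty)}$) with $S_i\in\mathcal A(\omega)[\eta]$.
   Context: $K$ is a spherically complete $p$-adic field (e.g. a finite extension of $\mathbb Q_p$) with absolute value $|\cdot|$ normalized by $|p|=p^{-1}$. $\omega=\sqrt[p-1]{1/p}\in\mathbb R$. $\mathcal A_t(1)$ is the ring of power series in $t$ over $K$ convergent for $|t|<1$; for $0<\lambda<1$ put $|\sum_{i\ge0}a_it^i|_\lambda=\sup_i|a_i|\lambda^i$. $\Phi^{(0,\infty)}[r]$ ($r\in\mathbb Z$) is the set of Laurent series $\sum_{j\le r}a_j(t)\eta^j$ with $a_j(t)\in\mathcal A_t(1)$ such that for all real $\lambda,\rho$ with $0<\rho<\omega\lambda<\omega$ one has $\limsup_{j\to-\infty}|a_j(t)|_\lambda\,\rho^{-j}=0$; $\Phi^{(0,\infty)}=\bigcup_r\Phi^{(0,\infty)}[r]$,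 a ring (of $p$-adic microdifferential operators of finite order) under $F\cdot G=\sum_{\alpha\ge0}\frac1{\alpha!}\partial_\eta^\alpha F\cdot\partial_t^\alpha G$ (commutative products on the right-hand side). The order $ord(F)$ of a nonzero $F=\sum_jf_j(t)\eta^j$ is the largest $r$ with $f_r\ne0$, and its principal symbol is $\sigma(F)=f_r(t)\eta^r$. $\mathcal A(\omega)[\eta]$ is the subring of Laurent series $\sum_{j\le r}a_j\eta^j$, $a_j\in K$, $r\in\mathbb Z$, such that $\limsup_{j\to-\infty}|a_j|\rho^{-j}=0$ for all $0<\rho<\omega$. For $F=\sum_uf_u(t)\eta^u\in\Phi^{(0,\infty)}$ and $0<\rho<\omega\lambda<\omega$ put $\|F\|_{\lambda,\rho}=\sup_u|f_u(t)|_\lambda\,\rho^{-u}$. $F$ is dominant if there is $\lambda_0<1$ such that for all $\lambda_0<\lambda<1$ and all $0<\rho<\omega\lambda$ one has $|f_{ord(F)}|_\lambda\,\rho^{-ord(F)}=\|F\|_{\lambda,\rho}$. *)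

theory Defs
  imports
    Complex_Main
    "HOL-Library.FuncSet"
    "HOL-Library.Extended_Real"
    "HOL-Library.Liminf_Limsup"
    "HOL-Computational_Algebra.Formal_Power_Series"
    "HOL-Computational_Algebra.Formal_Laurent_Series"
begin

section \<open>The base field\<close>

text \<open>
  The absolute value is an explicit function because the norm classes of the library
  are restricted to algebras over the reals. Spherical completeness is stated for
  decreasing sequences of closed balls; it implies completeness (hence that the field
  contains the p-adic numbers). Characteristic zero would follow from
  \<open>absv (of_nat p) = 1 / p\<close>; it is put into the type class only for convenience.
\<close>

definition val_cball :: "('k::field_char_0 \<Rightarrow> real) \<Rightarrow> 'k \<Rightarrow> real \<Rightarrow> 'k set" where
  "val_cball absv c r = {x. absv (x - c) \<le> r}"

definition spherically_complete :: "('k::field_char_0 \<Rightarrow> real) \<Rightarrow> bool" where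
  "spherically_complete absv \<longleftrightarrow>
     (\<forall>(c :: nat \<Rightarrow> 'k) r. (\<forall>n. 0 < r n) \<longrightarrow>
        (\<forall>n. val_cball absv (c (Suc n)) (r (Suc n)) \<subseteq> val_cball absv (c n) (r n)) \<longrightarrow>
        (\<Inter>n. val_cball absv (c n) (r n)) \<noteq> {})"

locale spherically_complete_padic_field =
  fixes p :: nat and absv :: "'k::field_char_0 \<Rightarrow> real"
  assumes prime_p: "prime p"
    and absv_nonneg: "0 \<le> absv x"
    and absv_eq_0_iff: "absv x = 0 \<longleftrightarrow> x = 0"
    and absv_mult: "absv (x * y) = absv x * absv y"
    and absv_ultrametric: "absv (x + y) \<le> max (absv x) (absv y)"
    and absv_p: "absv (of_nat p) = 1 / real p"
    and spherically_complete: "spherically_complete absv"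

definition omega :: "nat \<Rightarrow> real" where
  "omega p = root (p - 1) (1 / real p)"


section \<open>Power series on the open unit disc\<close>

text \<open>
  Convergence on the open unit disc is meant in the non-archimedean analytic sense
  (at all points of all complete extensions of the field), i.e. for every radius
  below 1, whether or not that radius is a value of \<open>absv\<close>.
\<close>

definition disc_series :: "('k::field_char_0 \<Rightarrow> real) \<Rightarrow> 'k fps set" where
  "disc_series absv = {a. \<forall>l. 0 < l \<and> l < 1 \<longrightarrow> (\<lambda>i. absv (fps_nth a i) * l ^ i) \<longlonglongrightarrow> 0}"

definition gauss_norm :: "('k::field_char_0 \<Rightarrow> real) \<Rightarrow> real \<Rightarrow> 'k fps \<Rightarrow> real" where
  "gauss_norm absv l a = (SUP i. absv (fps_nth a i) * l ^ i)"


section \<open>Formal operators\<close>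

text \<open>
  A series \<open>\<Sum>j\<le>r. a\<^sub>j(t) \<eta>^j\<close> is a formal Laurent series in the variable
  \<open>\<eta>^(-1)\<close> with coefficients in the power series in \<open>t\<close>: the variable \<open>fls_X\<close> is
  \<open>\<eta>^(-1)\<close>, so that the coefficient of \<open>\<eta>^j\<close> sits at index \<open>-j\<close>, and finiteness of
  the order is built into the type. The ring multiplication of this type is the
  commutative product.
\<close>

definition eta_coeff :: "'k::field_char_0 fps fls \<Rightarrow> int \<Rightarrow> 'k fps" where
  "eta_coeff F j = fls_nth F (- j)"

definition eta_monom :: "'k::field_char_0 fps \<Rightarrow> int \<Rightarrow> 'k fps fls" where
  "eta_monom a j = fls_const a * fls_X_intpow (- j)"

definition deriv_eta :: "'k::field_char_0 fps fls \<Rightarrow> 'k fps fls" where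
  "deriv_eta F = Abs_fls (\<lambda>n. of_int (1 - n) * fls_nth F (n - 1))"

definition deriv_t :: "'k::field_char_0 fps fls \<Rightarrow> 'k fps fls" where
  "deriv_t F = Abs_fls (\<lambda>n. fps_deriv (fls_nth F n))"

text \<open>
  The sum over \<open>\<alpha>\<close> is infinite, but each power of \<open>\<eta>\<close> receives only finitely many
  contributions, so it converges in the \<open>\<eta>^(-1)\<close>-adic topology of the type of
  formal Laurent series (see \<open>op_mult_sums\<close> and \<open>eta_coeff_op_mult\<close> below).
\<close>

definition op_mult_summand ::
    "'k::field_char_0 fps fls \<Rightarrow> 'k fps fls \<Rightarrow> nat \<Rightarrow> 'k fps fls" where
  "op_mult_summand F G \<alpha> =
     fls_const (fps_const (1 / fact \<alpha>)) * ((deriv_eta ^^ \<alpha>) F * (deriv_t ^^ \<alpha>) G)"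

definition op_mult ::
    "'k::field_char_0 fps fls \<Rightarrow> 'k fps fls \<Rightarrow> 'k fps fls"  (infixl \<open>\<odot>\<close> 70) where
  "F \<odot> G = (\<Sum>\<alpha>. op_mult_summand F G \<alpha>)"

lemma eta_coeff_eta_monom: "eta_coeff (eta_monom a j) k = (if k = j then a else 0)"
  by (auto simp: eta_coeff_def eta_monom_def fls_X_intpow_times_conv_shift)

lemma fls_nth_deriv_eta: "fls_nth (deriv_eta F) n = of_int (1 - n) * fls_nth F (n - 1)"
  unfolding deriv_eta_def
  by (rule nth_Abs_fls_lower_bound[of "fls_subdegree F"]) auto

lemma fls_nth_deriv_t: "fls_nth (deriv_t F) n = fps_deriv (fls_nth F n)"
  unfolding deriv_t_def
  by (rule nth_Abs_fls_lower_bound[of "fls_subdegree F"]) auto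

lemma eta_coeff_deriv_eta: "eta_coeff (deriv_eta F) j = of_int (j + 1) * eta_coeff F (j + 1)"
proof -
  have "- j - 1 = - (j + 1)" by simp
  thus ?thesis by (simp only: eta_coeff_def fls_nth_deriv_eta) (simp add: add.commute)
qed

lemma eta_coeff_deriv_t: "eta_coeff (deriv_t F) j = fps_deriv (eta_coeff F j)"
  by (simp add: eta_coeff_def fls_nth_deriv_t)

lemma deriv_eta_conv_fls_deriv: "deriv_eta F = - (fls_X ^ 2 * fls_deriv F)"
  by (rule fls_eqI)
     (simp add: fls_nth_deriv_eta fls_X_power_times_conv_shift algebra_simps)

lemma fls_nth_deriv_eta_pow_eq_0:
  "n < fls_subdegree F + int a \<Longrightarrow> fls_nth ((deriv_eta ^^ a) F) n = 0"
  by (induction a arbitrary: n) (auto simp: fls_nth_deriv_eta)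

lemma fls_nth_deriv_t_pow: "fls_nth ((deriv_t ^^ a) F) n = (fps_deriv ^^ a) (fls_nth F n)"
  by (induction a) (auto simp: fls_nth_deriv_t)

lemma fls_nth_deriv_t_pow_eq_0:
  "n < fls_subdegree F \<Longrightarrow> fls_nth ((deriv_t ^^ a) F) n = 0"
  by (induction a) (auto simp: fls_nth_deriv_t)

lemma fls_nth_mult_eq_0:
  fixes f g :: "'a::comm_ring_1 fls"
  assumes "\<And>i. i < c \<Longrightarrow> fls_nth f i = 0" "\<And>i. i < d \<Longrightarrow> fls_nth g i = 0" "n < c + d"
  shows "fls_nth (f * g) n = 0"
  unfolding fls_times_nth(2) using assms
  by (intro sum.neutral ballI) (smt (verit) mult_zero_left mult_zero_right)

lemma op_mult_summand_eq_0:
  assumes "n < fls_subdegree F + fls_subdegree G + int a"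
  shows "fls_nth (op_mult_summand F G a) n = 0"
proof -
  have "fls_nth ((deriv_eta ^^ a) F * (deriv_t ^^ a) G) n = 0"
    by (rule fls_nth_mult_eq_0[of "fls_subdegree F + int a" _ "fls_subdegree G"])
       (use assms in \<open>auto simp: fls_nth_deriv_eta_pow_eq_0 fls_nth_deriv_t_pow_eq_0\<close>)
  thus ?thesis by (simp add: op_mult_summand_def)
qed

lemma fls_sums_of_increasing_order:
  fixes f :: "nat \<Rightarrow> 'a::ab_group_add fls"
  assumes f: "\<And>a n. n < c + int a \<Longrightarrow> fls_nth (f a) n = 0"
  shows "\<exists>s. f sums s \<and> (\<forall>n. fls_nth s n = (\<Sum>a\<le>nat (n - c). fls_nth (f a) n))"
proof -
  define s where "s = Abs_fls (\<lambda>n. \<Sum>a\<le>nat (n - c). fls_nth (f a) n)"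
  have s: "fls_nth s n = (\<Sum>a\<le>nat (n - c). fls_nth (f a) n)" for n
    unfolding s_def
    by (rule nth_Abs_fls_lower_bound[of c]) (auto intro!: sum.neutral f)
  have part: "fls_nth (sum f {..<N}) n = fls_nth s n" if "n < c + int N" for n N
  proof (cases "n < c")
    case True
    thus ?thesis by (auto simp: s fls_nth_sum intro!: trans[OF sum.neutral] sum.neutral[symmetric] f)
  next
    case False
    with that show ?thesis
      unfolding s fls_nth_sum
      by (intro sum.mono_neutral_right) (auto intro!: f)
  qed
  have sub: "fls_subdegree (sum f {..<N} - s) \<ge> c + int N" if "sum f {..<N} \<noteq> s" for N
    using that part by (intro fls_subdegree_geI) auto
  have "(\<lambda>N. sum f {..<N}) \<longlonglongrightarrow> s"
  proof (rule metric_LIMSEQ_I)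
    fix e :: real assume "e > 0"
    then obtain k where k: "(1/2) ^ k < e"
      using real_arch_pow_inv[of e "1/2"] by auto
    have "dist (sum f {..<N}) s < e" if N: "N \<ge> nat (int k - c)" for N
    proof (cases "sum f {..<N} = s")
      case True thus ?thesis using \<open>e > 0\<close> by simp
    next
      case False
      let ?d = "fls_subdegree (sum f {..<N} - s)"
      have d: "?d \<ge> int k" using sub[OF False] N by linarith
      have "dist (sum f {..<N}) s = (1/2) ^ nat ?d"
        using False d by (simp add: dist_fls_def power_one_over inverse_eq_divide)
      also have "\<dots> \<le> (1/2) ^ k" using d by (intro power_decreasing) auto
      finally show ?thesis using k by simp
    qed
    thus "\<exists>no. \<forall>N\<ge>no. dist (sum f {..<N}) s < e" by blast
  qed
  thus ?thesis using s unfolding sums_def by blast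
qed

lemma op_mult_sums: "op_mult_summand F G sums (F \<odot> G)"
proof -
  obtain s where "op_mult_summand F G sums s"
    using fls_sums_of_increasing_order[where f = "op_mult_summand F G",
        OF op_mult_summand_eq_0[of _ F G]] by blast
  thus ?thesis unfolding op_mult_def using sums_unique by blast
qed

lemma eta_coeff_op_mult:
  "eta_coeff (F \<odot> G) j =
     (\<Sum>\<alpha>\<le>nat (- j - fls_subdegree F - fls_subdegree G). eta_coeff (op_mult_summand F G \<alpha>) j)"
proof -
  obtain s where "op_mult_summand F G sums s"
    and s: "\<And>n. fls_nth s n =
      (\<Sum>a\<le>nat (n - (fls_subdegree F + fls_subdegree G)). fls_nth (op_mult_summand F G a) n)"
    using fls_sums_of_increasing_order[where f = "op_mult_summand F G",
        OF op_mult_summand_eq_0[of _ F G]] by blast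
  hence "s = F \<odot> G" unfolding op_mult_def by (intro sums_unique)
  thus ?thesis using s[of "- j"] by (simp add: eta_coeff_def algebra_simps)
qed


section \<open>Microdifferential operators of finite order\<close>

definition microdiff_ops ::
    "nat \<Rightarrow> ('k::field_char_0 \<Rightarrow> real) \<Rightarrow> 'k fps fls set" where
  "microdiff_ops p absv =
     {F. (\<forall>j. eta_coeff F j \<in> disc_series absv) \<and>
         (\<forall>l \<rho>. 0 < \<rho> \<and> \<rho> < omega p * l \<and> omega p * l < omega p \<longrightarrow>
            Limsup at_bot (\<lambda>j. ereal (gauss_norm absv l (eta_coeff F j) * \<rho> powi (- j))) = 0)}"

definition const_coeff_ops ::
    "nat \<Rightarrow> ('k::field_char_0 \<Rightarrow> real) \<Rightarrow> 'k fps fls set" where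
  "const_coeff_ops p absv =
     {F. \<exists>a :: int \<Rightarrow> 'k. (\<forall>j. eta_coeff F j = fps_const (a j)) \<and>
         (\<forall>\<rho>. 0 < \<rho> \<and> \<rho> < omega p \<longrightarrow>
            Limsup at_bot (\<lambda>j. ereal (absv (a j) * \<rho> powi (- j))) = 0)}"

text \<open>Meaningful for nonzero operators only; the order of 0 is 0 here.\<close>

definition op_ord :: "'k::field_char_0 fps fls \<Rightarrow> int" where
  "op_ord F = - fls_subdegree F"

definition principal_symbol :: "'k::field_char_0 fps fls \<Rightarrow> 'k fps fls" where
  "principal_symbol F = eta_monom (eta_coeff F (op_ord F)) (op_ord F)"

definition op_norm ::
    "('k::field_char_0 \<Rightarrow> real) \<Rightarrow> real \<Rightarrow> real \<Rightarrow> 'k fps fls \<Rightarrow> real" where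
  "op_norm absv l \<rho> F = (SUP u. gauss_norm absv l (eta_coeff F u) * \<rho> powi (- u))"

definition dominant ::
    "nat \<Rightarrow> ('k::field_char_0 \<Rightarrow> real) \<Rightarrow> 'k fps fls \<Rightarrow> bool" where
  "dominant p absv F \<longleftrightarrow> F \<noteq> 0 \<and>
     (\<exists>l0<1. \<forall>l \<rho>. l0 < l \<and> l < 1 \<and> 0 < \<rho> \<and> \<rho> < omega p * l \<longrightarrow>
        gauss_norm absv l (eta_coeff F (op_ord F)) * \<rho> powi (- op_ord F) = op_norm absv l \<rho> F)"

end

theory Submission
  imports Defs
begin

text \<open>
  For \<open>\<rho> \<le> \<lambda>\<close> the norm of level \<open>(\<lambda>, \<rho>)\<close> is submultiplicative, and membership in
  \<open>\<Phi>\<close> amounts to finiteness of all norms with \<open>\<rho> < \<omega>\<lambda> < \<omega>\<close>. The quotient is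
  computed one power of \<open>\<eta>\<close> at a time, from the top: the leading coefficient of the current
  remainder is divided by \<open>t^m b\<close>, with the polynomial part of degree \<open>< m\<close> left over.
  Dominance together with \<open>|t^m b|\<^sub>\<lambda> = \<lambda>^m |b(0)|\<close> says that subtracting the resulting
  multiple of \<open>F\<close> does not increase the norm for \<open>\<lambda>\<close> close to 1, so the formal quotient has
  finite norms. Uniqueness is formal: a nonzero multiple of \<open>F\<close> has a leading coefficient
  divisible by \<open>t^m\<close>.
\<close>

text \<open>A predicate rather than a supremum: finiteness of the norm is then a statement to prove,
  not a presupposition of \<open>SUP\<close>. Since index \<open>n\<close> carries \<eta>^(-n), the
  weight \<open>\<rho> powi n\<close> is the \<rho>^(-j) of the norm.\<close>

definition op_bound ::
    "('k::field_char_0 \<Rightarrow> real) \<Rightarrow> real \<Rightarrow> real \<Rightarrow> 'k fps fls \<Rightarrow> real \<Rightarrow> bool" where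
  "op_bound absv l \<rho> F C \<longleftrightarrow>
     (\<forall>n i. absv (fps_nth (fls_nth F n) i) * (l ^ i * \<rho> powi n) \<le> C)"

lemma op_boundD:
  "op_bound absv l \<rho> F C \<Longrightarrow> absv (fps_nth (fls_nth F n) i) * (l ^ i * \<rho> powi n) \<le> C"
  by (simp add: op_bound_def)

lemma op_bound_mono: "op_bound absv l \<rho> F C \<Longrightarrow> C \<le> D \<Longrightarrow> op_bound absv l \<rho> F D"
  unfolding op_bound_def by (meson order_trans)

section \<open>Formal properties of the product\<close>

text \<open>The factor is kept as an image of an integer, because integers have absolute value at
  most 1.\<close>

lemma fls_nth_deriv_eta_funpow:
  "fls_nth ((deriv_eta ^^ a) F) n = of_int (\<Prod>k<a. int k + 1 - n) * fls_nth F (n - int a)"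
proof (induction a arbitrary: n)
  case (Suc a)
  have "fls_nth ((deriv_eta ^^ Suc a) F) n
      = of_int (1 - n) * (of_int (\<Prod>k<a. int k + 1 - (n - 1)) * fls_nth F (n - 1 - int a))"
    by (simp add: fls_nth_deriv_eta Suc.IH)
  also have "\<dots> = of_int (\<Prod>k<Suc a. int k + 1 - n) * fls_nth F (n - int (Suc a))"
  proof -
    have "(\<Prod>k<Suc a. int k + 1 - n) = (1 - n) * (\<Prod>k<a. int k + 1 - (n - 1))"
      unfolding prod.lessThan_Suc_shift by (auto intro!: prod.cong)
    moreover have "n - 1 - int a = n - int (Suc a)"
      by simp
    ultimately show ?thesis
      by (simp only: of_int_mult mult.assoc)
  qed
  finally show ?case .
qed simp

text \<open>Splitting off \<open>fact a\<close> lets it cancel against the 1/a! of the product; what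
  remains is a binomial coefficient, hence of absolute value at most 1.\<close>

lemma fps_nth_deriv_funpow:
  "fps_nth ((fps_deriv ^^ a) f) i
     = fact a * of_nat ((i + a) choose a) * (fps_nth f (i + a) :: 'k::field_char_0)"
proof (induction a arbitrary: i)
  case (Suc a)
  \<comment> \<open>Both sides equal \<open>Suc (i + a)\<close> times
    \<open>(i + a) choose a\<close>, by the two absorption identities.\<close>
  have "Suc i * (Suc (i + a) choose a) = Suc a * (Suc (i + a) choose Suc a)"
    using binomial_absorb_comp[of "Suc (i + a)" a] binomial_absorption[of a "Suc (i + a)"] by simp
  hence "(Suc i) * (fact a * ((Suc i + a) choose a)) = (fact (Suc a) * ((i + Suc a) choose Suc a) :: nat)"
    by (simp del: binomial_Suc_Suc mult_Suc mult_Suc_right add: mult.left_commute[of _ "fact a"])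
  hence "of_nat (Suc i) * (fact a * of_nat ((Suc i + a) choose a))
      = (fact (Suc a) * of_nat ((i + Suc a) choose Suc a) :: 'k)"
    by (metis (mono_tags, lifting) of_nat_fact of_nat_mult)
  thus ?case by (simp add: Suc.IH mult.assoc[symmetric] del: of_nat_Suc fact_Suc)
qed simp

lemma fps_nth_of_nat_mult: "fps_nth (of_nat k * f) i = of_nat k * fps_nth f i"
  by (simp only: fps_of_nat[symmetric] fps_mult_left_const_nth)

text \<open>Summand \<open>a\<close> starts at index \<open>c + d + a\<close> at the earliest, so
  any long enough truncation is exact. Arbitrary lower bounds \<open>c\<close>, \<open>d\<close>
  replace the subdegrees because differences and zero operators occur, whose subdegrees are not
  under control.\<close>

lemma fls_nth_op_mult:
  assumes "\<And>n. n < c \<Longrightarrow> fls_nth F n = 0" "\<And>n. n < d \<Longrightarrow> fls_nth G n = 0"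
    and N: "n - c - d \<le> int N"
  shows "fls_nth (F \<odot> G) n = (\<Sum>a\<le>N. fls_nth (op_mult_summand F G a) n)"
proof -
  have z: "fls_nth (op_mult_summand F G a) n = 0" if "n < c + d + int a" for a n
  proof -
    have "fls_nth ((deriv_eta ^^ a) F * (deriv_t ^^ a) G) n = 0"
    proof (rule fls_nth_mult_eq_0[of "c + int a" _ d])
      show "fls_nth ((deriv_eta ^^ a) F) i = 0" if "i < c + int a" for i
        using assms(1)[of "i - int a"] that by (simp add: fls_nth_deriv_eta_funpow)
      show "fls_nth ((deriv_t ^^ a) G) i = 0" if "i < d" for i
        using assms(2)[OF that] by (simp add: fls_nth_deriv_t_pow fps_eq_iff fps_nth_deriv_funpow)
    qed (use that in simp)
    thus ?thesis by (simp add: op_mult_summand_def)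
  qed
  obtain s where s: "op_mult_summand F G sums s"
    "\<And>n. fls_nth s n = (\<Sum>a\<le>nat (n - (c + d)). fls_nth (op_mult_summand F G a) n)"
    using fls_sums_of_increasing_order[where f = "op_mult_summand F G", OF z] by blast
  have "fls_nth (F \<odot> G) n = (\<Sum>a\<le>nat (n - (c + d)). fls_nth (op_mult_summand F G a) n)"
    using s sums_unique2[OF op_mult_sums s(1)] by simp
  also have "\<dots> = (\<Sum>a\<le>N. fls_nth (op_mult_summand F G a) n)"
    using N by (intro sum.mono_neutral_left) (auto intro!: z)
  finally show ?thesis .
qed

text \<open>Stated for all large \<open>N\<close> so that several products can be truncated at a
  common place.\<close>

lemma fls_nth_op_mult_ev:
  "\<exists>N0. \<forall>N\<ge>N0. fls_nth (F \<odot> G) n = (\<Sum>a\<le>N. fls_nth (op_mult_summand F G a) n)"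
proof (intro exI allI impI)
  fix N assume "nat (n - fls_subdegree F - fls_subdegree G) \<le> N"
  thus "fls_nth (F \<odot> G) n = (\<Sum>a\<le>N. fls_nth (op_mult_summand F G a) n)"
    by (intro fls_nth_op_mult[of "fls_subdegree F" _ "fls_subdegree G"]) auto
qed

lemma op_mult_eq_0_below:
  assumes "\<And>n. n < c \<Longrightarrow> fls_nth F n = 0" "\<And>n. n < d \<Longrightarrow> fls_nth G n = 0" "n < c + d"
  shows "fls_nth (F \<odot> G) n = 0"
proof -
  have "fls_nth (op_mult_summand F G 0) n = 0"
    using fls_nth_mult_eq_0[OF assms] by (simp add: op_mult_summand_def)
  moreover have "fls_nth (F \<odot> G) n = (\<Sum>a\<le>0. fls_nth (op_mult_summand F G a) n)"
    by (rule fls_nth_op_mult[of c _ d]) (use assms in auto)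
  ultimately show ?thesis by simp
qed

text \<open>Only the summand \<open>a = 0\<close>, the commutative product, reaches the lowest
  index: principal symbols multiply commutatively.\<close>

lemma op_mult_lowest:
  assumes "\<And>n. n < c \<Longrightarrow> fls_nth F n = 0" "\<And>n. n < d \<Longrightarrow> fls_nth G n = 0"
  shows "fls_nth (F \<odot> G) (c + d) = fls_nth F c * fls_nth G d"
proof -
  have F: "fls_nth F i = 0" if "i < c" for i using assms(1) that .
  have G: "fls_nth G i = 0" if "i < d" for i using assms(2) that .
  have "fls_nth (F * G) (c + d) = (\<Sum>i\<in>{fls_subdegree F..c + d - fls_subdegree G}. fls_nth F i * fls_nth G (c + d - i))"
    by (simp add: fls_times_nth(2))
  \<comment> \<open>As \<open>c\<close> and \<open>d\<close> are mere lower bounds, \<open>c\<close>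
    may fall outside the range of summation; then one of the two factors vanishes.\<close>
  also have "\<dots> = (\<Sum>i\<in>{c} \<inter> {fls_subdegree F..c + d - fls_subdegree G}. fls_nth F i * fls_nth G (c + d - i))"
  proof (rule sum.mono_neutral_right)
    show "\<forall>i\<in>{fls_subdegree F..c + d - fls_subdegree G} - {c} \<inter> {fls_subdegree F..c + d - fls_subdegree G}.
       fls_nth F i * fls_nth G (c + d - i) = 0"
    proof
      fix i assume "i \<in> {fls_subdegree F..c + d - fls_subdegree G} - {c} \<inter> {fls_subdegree F..c + d - fls_subdegree G}"
      hence "i < c \<or> c + d - i < d" by auto
      thus "fls_nth F i * fls_nth G (c + d - i) = 0" using F G by auto
    qed
  qed auto
  also have "\<dots> = fls_nth F c * fls_nth G d"
  proof (cases "c \<in> {fls_subdegree F..c + d - fls_subdegree G}")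
    case False
    hence "fls_nth F c * fls_nth G d = 0" by auto
    thus ?thesis using False by simp
  qed simp
  finally have "fls_nth (op_mult_summand F G 0) (c + d) = fls_nth F c * fls_nth G d"
    by (simp add: op_mult_summand_def)
  moreover have "fls_nth (F \<odot> G) (c + d) = (\<Sum>a\<le>0. fls_nth (op_mult_summand F G a) (c + d))"
    by (rule fls_nth_op_mult[of c _ d]) (use assms in auto)
  ultimately show ?thesis by simp
qed

lemma op_mult_diff_left: "(F - G) \<odot> H = F \<odot> H - G \<odot> H"
proof (rule fls_eqI)
  fix n
  have dist: "(deriv_eta ^^ a) (F - G) = (deriv_eta ^^ a) F - (deriv_eta ^^ a) G" for a
    by (rule fls_eqI) (simp add: fls_nth_deriv_eta_funpow algebra_simps)
  obtain N1 where N1: "\<forall>N\<ge>N1. fls_nth ((F - G) \<odot> H) n = (\<Sum>a\<le>N. fls_nth (op_mult_summand (F - G) H a) n)"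
    using fls_nth_op_mult_ev by blast
  obtain N2 where N2: "\<forall>N\<ge>N2. fls_nth (F \<odot> H) n = (\<Sum>a\<le>N. fls_nth (op_mult_summand F H a) n)"
    using fls_nth_op_mult_ev by blast
  obtain N3 where N3: "\<forall>N\<ge>N3. fls_nth (G \<odot> H) n = (\<Sum>a\<le>N. fls_nth (op_mult_summand G H a) n)"
    using fls_nth_op_mult_ev by blast
  define N where "N = max N1 (max N2 N3)"
  have "N \<ge> N1" "N \<ge> N2" "N \<ge> N3" by (auto simp: N_def)
  thus "fls_nth ((F - G) \<odot> H) n = fls_nth (F \<odot> H - G \<odot> H) n"
    using N1 N2 N3
    by (simp add: op_mult_summand_def dist left_diff_distrib right_diff_distrib sum_subtractf)
qed

lemma op_mult_zero_left [simp]: "0 \<odot> H = 0"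
  using op_mult_diff_left[of 0 0 H] by simp

lemma op_mult_add_left: "(F + G) \<odot> H = F \<odot> H + G \<odot> H"
  using op_mult_diff_left[of "F + G" G H] by (simp add: algebra_simps)

section \<open>Products of powers of t with constant coefficient operators\<close>

lemma eta_monom_0: "eta_monom a 0 = fls_const a"
  by (simp add: eta_monom_def)

lemma fls_nth_eta_monom: "fls_nth (eta_monom a j) n = (if n = - j then a else 0)"
  using eta_coeff_eta_monom[of a j "- n"] by (auto simp: eta_coeff_def)

text \<open>All t-derivatives of \<open>R\<close> vanish, so with \<open>t^k\<close> on the left the
  product is the commutative one.\<close>

lemma t_power_op_mult_const:
  assumes "\<And>n i. 0 < i \<Longrightarrow> fps_nth (fls_nth R n) i = 0"
  shows "fps_nth (fls_nth (eta_monom (fps_X ^ k) 0 \<odot> R) n) i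
           = (if i = k then fps_nth (fls_nth R n) 0 else 0)"
proof -
  have z: "op_mult_summand (fls_const (fps_X ^ k)) R a = 0" if "a > 0" for a
  proof -
    have "(deriv_t ^^ a) R = 0"
      using that by (intro fls_eqI) (simp add: fls_nth_deriv_t_pow fps_eq_iff fps_nth_deriv_funpow assms)
    thus ?thesis by (simp add: op_mult_summand_def)
  qed
  obtain N where "fls_nth (fls_const (fps_X ^ k) \<odot> R) n
      = (\<Sum>a\<le>N. fls_nth (op_mult_summand (fls_const (fps_X ^ k)) R a) n)"
    using fls_nth_op_mult_ev by blast
  also have "\<dots> = (\<Sum>a\<in>{0}. fls_nth (op_mult_summand (fls_const (fps_X ^ k)) R a) n)"
    by (rule sum.mono_neutral_right) (auto simp: z)
  also have "\<dots> = fps_X ^ k * fls_nth R n"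
    by (simp add: op_mult_summand_def)
  finally show ?thesis
    using assms by (auto simp: eta_monom_0 fps_X_power_mult_nth)
qed

text \<open>Leibniz rule: with \<open>t^k\<close> on the right the product is the sum over
  \<open>a\<close> of \<open>(k choose a)\<close> t^(k-a) times the \<open>a\<close>-th
  \<eta>-derivative of \<open>S\<close>. The coefficient of \<open>t^i\<close> selects
  \<open>a = k - i\<close>.\<close>

lemma const_op_mult_t_power:
  fixes S :: "'k::field_char_0 fps fls"
  assumes "\<And>n i. 0 < i \<Longrightarrow> fps_nth (fls_nth S n) i = 0"
  shows "fps_nth (fls_nth (S \<odot> eta_monom (fps_X ^ k) 0) n) i
           = (if i \<le> k then of_nat (k choose i) * fps_nth (fls_nth ((deriv_eta ^^ (k - i)) S) n) 0 else 0)"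
proof -
  define T :: "'k fps fls" where "T = fls_const (fps_X ^ k)"
  define D where "D a = (deriv_eta ^^ a) S" for a
  have D: "fps_nth (fls_nth (D a) n) j = 0" if "j > 0" for a n j
    using that assms by (simp add: D_def fls_nth_deriv_eta_funpow fps_of_int[symmetric] fps_mult_left_const_nth)
  have dT: "(deriv_t ^^ a) T = fls_const ((fps_deriv ^^ a) (fps_X ^ k))" for a
    by (rule fls_eqI) (auto simp: fls_nth_deriv_t_pow T_def fps_eq_iff fps_nth_deriv_funpow)
  have summand: "fps_nth (fls_nth (op_mult_summand S T a) n) i
      = (if i + a = k then of_nat (k choose i) * fps_nth (fls_nth (D a) n) 0 else 0)" for a
  proof -
    have "fls_nth (op_mult_summand S T a) n
       = fps_const (1 / fact a) * ((fps_deriv ^^ a) (fps_X ^ k) * fls_nth (D a) n)"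
      by (simp add: op_mult_summand_def dT D_def mult.commute[of _ "fls_const ((fps_deriv ^^ a) (fps_X ^ k))"])
    also have "fls_nth (D a) n = fps_const (fps_nth (fls_nth (D a) n) 0)"
      by (rule fps_ext) (auto simp: D)
    finally have "fps_nth (fls_nth (op_mult_summand S T a) n) i
       = 1 / fact a * (fps_nth ((fps_deriv ^^ a) (fps_X ^ k)) i * fps_nth (fls_nth (D a) n) 0)"
      by (simp only: fps_mult_left_const_nth fps_mult_right_const_nth)
    also have "\<dots> = (if i + a = k then of_nat (k choose i) * fps_nth (fls_nth (D a) n) 0 else 0)"
      by (auto simp: fps_nth_deriv_funpow binomial_symmetric[of a "i + a"])
    finally show ?thesis .
  qed
  obtain N0 where N0: "\<forall>N\<ge>N0. fls_nth (S \<odot> T) n = (\<Sum>a\<le>N. fls_nth (op_mult_summand S T a) n)"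
    using fls_nth_op_mult_ev by blast
  \<comment> \<open>Truncating at \<open>max N0 k\<close> makes sure that the only contributing
    index \<open>k - i\<close> is in range.\<close>
  have "fps_nth (fls_nth (S \<odot> T) n) i
      = (\<Sum>a\<le>max N0 k. if i + a = k then of_nat (k choose i) * fps_nth (fls_nth (D a) n) 0 else 0)"
    by (subst N0[rule_format, of "max N0 k"]) (auto simp: fps_sum_nth summand)
  also have "\<dots> = (\<Sum>a\<in>(if i \<le> k then {k - i} else {}). of_nat (k choose i) * fps_nth (fls_nth (D a) n) 0)"
    by (rule sum.mono_neutral_cong_right) (auto split: if_splits)
  finally show ?thesis by (auto simp: eta_monom_0 T_def D_def)
qed


text \<open>Power series form a domain, so the lowest coefficient of the product is
  \<open>t^m\<close> times a nonzero series and has a term of degree at least \<open>m\<close>.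
  Applied to the difference of two quotients.\<close>

lemma right_divisor_eq_0:
  assumes F: "fls_nth F (fls_subdegree F) = fps_X ^ m * b" "b \<noteq> 0"
    and low: "\<And>n i. m \<le> i \<Longrightarrow> fps_nth (fls_nth (Q \<odot> F) n) i = 0"
  shows "Q = 0"
proof (rule ccontr)
  assume "Q \<noteq> 0"
  define q where "q = fls_nth Q (fls_subdegree Q)"
  have "q * b \<noteq> 0"
    using \<open>Q \<noteq> 0\<close> F(2) by (simp add: q_def)
  then obtain i where "fps_nth (q * b) i \<noteq> 0"
    by (auto simp: fps_eq_iff)
  hence "fps_nth (fps_X ^ m * (q * b)) (m + i) \<noteq> 0"
    by (simp add: fps_X_power_mult_nth)
  moreover have "fls_nth (Q \<odot> F) (fls_subdegree Q + fls_subdegree F) = fps_X ^ m * (q * b)"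
    by (subst op_mult_lowest) (auto simp: F q_def algebra_simps)
  ultimately show False by (metis le_add1 low)
qed

text \<open>Sorts a remainder of degree below \<open>m\<close> in t by powers of t;
  \<open>R k\<close> collects the coefficients of \<open>t^k\<close> for all powers of
  \<eta>.\<close>

lemma low_degree_decomposition:
  assumes "\<And>n i. m \<le> i \<Longrightarrow> fps_nth (fls_nth H n) i = 0"
    and "\<And>k n i. k < m \<Longrightarrow> fps_nth (fls_nth (R k) n) i = (if i = 0 then fps_nth (fls_nth H n) k else 0)"
  shows "H = (\<Sum>k<m. eta_monom (fps_X ^ k) 0 \<odot> R k)"
proof (rule fls_eqI, rule fps_ext)
  fix n i
  have "fps_nth (fls_nth (\<Sum>k<m. eta_monom (fps_X ^ k) 0 \<odot> R k) n) i
      = (\<Sum>k<m. if i = k then fps_nth (fls_nth H n) k else 0)"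
    unfolding fls_nth_sum fps_sum_nth
    by (intro sum.cong refl, subst t_power_op_mult_const) (auto simp: assms(2))
  thus "fps_nth (fls_nth H n) i = fps_nth (fls_nth (\<Sum>k<m. eta_monom (fps_X ^ k) 0 \<odot> R k) n) i"
    using assms(1) by simp
qed

text \<open>Each \<open>R i\<close> can be read off from the sum, which gives uniqueness of the
  remainders.\<close>

lemma fps_nth_t_power_sum:
  assumes "\<And>k n i. k < m \<Longrightarrow> 0 < i \<Longrightarrow> fps_nth (fls_nth (R k) n) i = 0"
  shows "fps_nth (fls_nth (\<Sum>k<m. eta_monom (fps_X ^ k) 0 \<odot> R k) n) i
           = (if i < m then fps_nth (fls_nth (R i) n) 0 else 0)"
proof -
  have "fps_nth (fls_nth (\<Sum>k<m. eta_monom (fps_X ^ k) 0 \<odot> R k) n) i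
      = (\<Sum>k<m. if i = k then fps_nth (fls_nth (R k) n) 0 else 0)"
    unfolding fls_nth_sum fps_sum_nth
    by (intro sum.cong refl, subst t_power_op_mult_const) (auto simp: assms)
  thus ?thesis by simp
qed

section \<open>Norm estimates\<close>

text \<open>Finitely many indices separate the region where \<open>h < 1\<close> from the one where
  \<open>h\<close> vanishes; the sum of their absolute values covers them.\<close>

lemma Limsup_zero_imp_bounded:
  fixes h :: "int \<Rightarrow> real"
  assumes "\<And>j. j > J \<Longrightarrow> h j = 0" "Limsup at_bot (\<lambda>j. ereal (h j)) = 0"
  shows "\<exists>C. \<forall>j. h j \<le> C"
proof -
  have "\<forall>\<^sub>F j in at_bot. ereal (h j) < 1"
    by (rule Limsup_lessD) (simp add: assms)
  then obtain M where M: "\<And>j. j \<le> M \<Longrightarrow> h j < 1"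
    by (auto simp: eventually_at_bot_linorder one_ereal_def)
  have "h j \<le> 1 + (\<Sum>j\<in>{M..J}. \<bar>h j\<bar>)" for j
  proof -
    have pos: "0 \<le> (\<Sum>j\<in>{M..J}. \<bar>h j\<bar>)" by (simp add: sum_nonneg)
    consider "j \<le> M" | "j > J" | "j \<in> {M..J}" by fastforce
    thus ?thesis
    proof cases
      case 1 thus ?thesis using M[OF 1] pos by linarith
    next
      case 2 thus ?thesis using assms(1)[OF 2] pos by linarith
    next
      case 3
      hence "\<bar>h j\<bar> \<le> (\<Sum>j\<in>{M..J}. \<bar>h j\<bar>)" by (intro member_le_sum) auto
      thus ?thesis by linarith
    qed
  qed
  thus ?thesis by blast
qed

text \<open>Passing from \<rho>' to a smaller \<rho> gains the geometric factor
  (\<rho>/\<rho>')^(-j). The conditions on \<rho> are open, so a larger radius is always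
  available.\<close>

lemma bounded_imp_Limsup_zero:
  fixes g :: "int \<Rightarrow> real"
  assumes \<rho>: "0 < \<rho>" "\<rho> < \<rho>'" and g: "\<And>j. 0 \<le> g j" "\<And>j. g j * \<rho>' powi (- j) \<le> C"
  shows "Limsup at_bot (\<lambda>j. ereal (g j * \<rho> powi (- j))) = 0"
proof -
  have lim: "((\<lambda>j::int. C * (\<rho> / \<rho>') ^ nat (- j)) \<longlongrightarrow> C * 0) at_bot"
  proof (rule tendsto_mult_left, rule filterlim_compose[OF LIMSEQ_power_zero])
    show "norm (\<rho> / \<rho>') < 1" using \<rho> by simp
    show "filterlim (\<lambda>j::int. nat (- j)) at_top at_bot"
      unfolding filterlim_at_top
    proof
      fix Z :: nat
      show "\<forall>\<^sub>F j in at_bot. Z \<le> nat (- j)"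
        by (rule eventually_mono[OF eventually_le_at_bot[of "- int Z"]]) auto
    qed
  qed
  have "((\<lambda>j. g j * \<rho> powi (- j)) \<longlongrightarrow> 0) at_bot"
  proof (rule tendsto_sandwich)
    show "\<forall>\<^sub>F j in at_bot. 0 \<le> g j * \<rho> powi (- j)"
      using g(1) \<rho> by (simp add: zero_le_power_int)
    show "\<forall>\<^sub>F j in at_bot. g j * \<rho> powi (- j) \<le> C * (\<rho> / \<rho>') ^ nat (- j)"
    proof (rule eventually_mono[OF eventually_le_at_bot[of 0]])
      fix j :: int assume "j \<le> 0"
      have "g j * \<rho> powi (- j) = (g j * \<rho>' powi (- j)) * (\<rho> / \<rho>') powi (- j)"
        using \<rho> by (simp add: power_int_divide_distrib)
      also have "\<dots> \<le> C * (\<rho> / \<rho>') powi (- j)"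
        using g(2) \<rho> by (intro mult_right_mono) (auto intro!: zero_le_power_int)
      also have "(\<rho> / \<rho>') powi (- j) = (\<rho> / \<rho>') ^ nat (- j)"
        using \<open>j \<le> 0\<close> by (simp add: power_int_def)
      finally show "g j * \<rho> powi (- j) \<le> C * (\<rho> / \<rho>') ^ nat (- j)" .
    qed
  qed (use lim in auto)
  hence "((\<lambda>j. ereal (g j * \<rho> powi (- j))) \<longlongrightarrow> ereal 0) at_bot"
    by simp
  hence "Limsup at_bot (\<lambda>j. ereal (g j * \<rho> powi (- j))) = ereal 0"
    by (intro lim_imp_Limsup) auto
  thus ?thesis by (simp add: zero_ereal_def)
qed

context spherically_complete_padic_field
begin

section \<open>The absolute value and the number \<open>omega\<close>\<close>

lemma absv_0 [simp]: "absv 0 = 0"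
  by (simp add: absv_eq_0_iff)

lemma absv_pos: "x \<noteq> 0 \<Longrightarrow> 0 < absv x"
  using absv_nonneg[of x] absv_eq_0_iff[of x] by linarith

lemma absv_1 [simp]: "absv 1 = 1"
  using absv_mult[of 1 1] absv_eq_0_iff[of 1] by simp

lemma absv_minus [simp]: "absv (- x) = absv x"
proof -
  have "absv (- 1) * absv (- 1) = 1" using absv_mult[of "- 1" "- 1"] by simp
  hence "absv (- 1) = 1"
    using absv_nonneg[of "- 1"] by (metis abs_of_nonneg abs_square_eq_1 power2_eq_square)
  thus ?thesis using absv_mult[of "- 1" x] by simp
qed

lemma absv_of_nat: "absv (of_nat n) \<le> 1"
proof (induction n)
  case (Suc n)
  thus ?case using absv_ultrametric[of 1 "of_nat n"] by simp
qed simp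

lemma absv_of_int: "absv (of_int n) \<le> 1"
  by (cases n rule: int_cases2) (auto simp: absv_of_nat)

text \<open>Ultrametric inequality with the weight carried along, in the shape of
  \<open>op_bound\<close>. The assumption \<open>0 \<le> C\<close> handles sums with value 0 by
  convention.\<close>

lemma absv_sum_weighted:
  assumes "\<And>x. x \<in> A \<Longrightarrow> absv (f x) * w \<le> C" "0 \<le> C" "0 \<le> w"
  shows "absv (sum f A) * w \<le> C"
  using assms(1)
proof (induction A rule: infinite_finite_induct)
  case (insert x A)
  have "absv (sum f (insert x A)) * w \<le> max (absv (f x)) (absv (sum f A)) * w"
    using insert.hyps absv_ultrametric assms(3) by (simp add: mult_right_mono)
  also have "\<dots> \<le> C" using insert by (auto simp: max_def)
  finally show ?case .
qed (use assms in auto)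

lemma omega_pos: "0 < omega p"
proof -
  have "p \<ge> 2" using prime_p by (rule prime_ge_2_nat)
  thus ?thesis by (simp add: omega_def)
qed

text \<open>Turns \<open>\<rho> < omega p * l\<close> into \<open>\<rho> \<le> l\<close>, the range
  in which the norms are submultiplicative.\<close>

lemma omega_le_1: "omega p \<le> 1"
proof -
  have "p \<ge> 2" using prime_p by (rule prime_ge_2_nat)
  thus ?thesis by (simp add: omega_def)
qed

section \<open>Gauss norms and convergence on the open disc\<close>

lemma gauss_norm_upper:
  assumes "a \<in> disc_series absv" "0 < l" "l < 1"
  shows "absv (fps_nth a i) * l ^ i \<le> gauss_norm absv l a"
proof -
  \<comment> \<open>A real \<open>SUP\<close> is an upper bound only of a bounded family;
    boundedness comes from convergence to 0.\<close>
  have "(\<lambda>i. absv (fps_nth a i) * l ^ i) \<longlonglongrightarrow> 0"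
    using assms by (simp add: disc_series_def)
  hence "Bseq (\<lambda>i. absv (fps_nth a i) * l ^ i)"
    by (intro convergent_imp_Bseq) (auto simp: convergent_def)
  hence "bdd_above (range (\<lambda>i. absv (fps_nth a i) * l ^ i))"
    by (intro Bseq_bdd_above)
  thus ?thesis unfolding gauss_norm_def by (intro cSUP_upper) auto
qed

lemma gauss_norm_least: "(\<And>i. absv (fps_nth a i) * l ^ i \<le> C) \<Longrightarrow> gauss_norm absv l a \<le> C"
  unfolding gauss_norm_def by (rule cSUP_least) auto

lemma gauss_norm_nonneg: "a \<in> disc_series absv \<Longrightarrow> 0 < l \<Longrightarrow> l < 1 \<Longrightarrow> 0 \<le> gauss_norm absv l a"
  using gauss_norm_upper[of a l 0] absv_nonneg[of "fps_nth a 0"] by simp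

lemma gauss_norm_zero [simp]: "gauss_norm absv l 0 = 0"
  by (simp add: gauss_norm_def)

text \<open>A bound at a radius strictly between \<open>l\<close> and 1 forces geometric decay at
  \<open>l\<close>.\<close>

lemma disc_seriesI:
  assumes "\<And>l. 0 < l \<Longrightarrow> l < 1 \<Longrightarrow> \<exists>C. \<forall>i. absv (fps_nth a i) * l ^ i \<le> C"
  shows "a \<in> disc_series absv"
  unfolding disc_series_def
proof (intro CollectI allI impI)
  fix l :: real assume l: "0 < l \<and> l < 1"
  define l' where "l' = (l + 1) / 2"
  have l': "l < l'" "l' < 1" using l by (auto simp: l'_def)
  then obtain C where C: "\<And>i. absv (fps_nth a i) * l' ^ i \<le> C"
    using assms[of l'] l by auto
  have lim: "(\<lambda>i. C * (l / l') ^ i) \<longlonglongrightarrow> C * 0"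
    by (rule tendsto_mult_left, rule LIMSEQ_power_zero) (use l l' in simp)
  show "(\<lambda>i. absv (fps_nth a i) * l ^ i) \<longlonglongrightarrow> 0"
  proof (rule tendsto_sandwich[OF _ _ tendsto_const])
    show "\<forall>\<^sub>F i in sequentially. absv (fps_nth a i) * l ^ i \<le> C * (l / l') ^ i"
    proof (intro always_eventually allI)
      fix i
      have "absv (fps_nth a i) * l ^ i = absv (fps_nth a i) * l' ^ i * (l / l') ^ i"
        using l l' by (simp add: power_divide)
      also have "\<dots> \<le> C * (l / l') ^ i"
        using C l l' by (intro mult_right_mono) auto
      finally show "absv (fps_nth a i) * l ^ i \<le> C * (l / l') ^ i" .
    qed
  qed (use l absv_nonneg lim in auto)
qed

section \<open>Membership in the operator rings expressed by bounds\<close>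

lemma op_bound_nonneg: "op_bound absv l \<rho> F C \<Longrightarrow> 0 < l \<Longrightarrow> 0 < \<rho> \<Longrightarrow> 0 \<le> C"
  using op_boundD[of absv l \<rho> F C 0 0] absv_nonneg[of "fps_nth (fls_nth F 0) 0"] by simp

text \<open>Exponents of t are nonnegative, so weights only shrink with \<open>l\<close>. This
  carries bounds obtained near 1 to every smaller radius.\<close>

lemma op_bound_mono_radius:
  assumes "op_bound absv l' \<rho> F C" "0 < l" "l \<le> l'" "0 < \<rho>"
  shows "op_bound absv l \<rho> F C"
  unfolding op_bound_def
proof (intro allI)
  fix n i
  have "absv (fps_nth (fls_nth F n) i) * (l ^ i * \<rho> powi n)
      \<le> absv (fps_nth (fls_nth F n) i) * (l' ^ i * \<rho> powi n)"
    using assms absv_nonneg by (intro mult_left_mono mult_right_mono power_mono) (auto intro: zero_le_power_int)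
  thus "absv (fps_nth (fls_nth F n) i) * (l ^ i * \<rho> powi n) \<le> C"
    using op_boundD[OF assms(1), of n i] by linarith
qed

lemma microdiff_ops_op_bound:
  assumes F: "F \<in> microdiff_ops p absv" and "0 < \<rho>" "\<rho> < omega p * l" "l < 1"
  shows "\<exists>C. op_bound absv l \<rho> F C"
proof -
  have l: "0 < l" using zero_less_mult_pos[OF less_trans[OF assms(2,3)] omega_pos] .
  have disc: "eta_coeff F j \<in> disc_series absv" for j
    using F by (auto simp: microdiff_ops_def)
  have lim: "Limsup at_bot (\<lambda>j. ereal (gauss_norm absv l (eta_coeff F j) * \<rho> powi (- j))) = 0"
    using F assms omega_pos by (auto simp: microdiff_ops_def)
  have "gauss_norm absv l (eta_coeff F j) * \<rho> powi (- j) = 0" if "j > - fls_subdegree F" for j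
    using that by (simp add: eta_coeff_def)
  then obtain C where C: "\<And>j. gauss_norm absv l (eta_coeff F j) * \<rho> powi (- j) \<le> C"
    using Limsup_zero_imp_bounded[OF _ lim] by blast
  have "absv (fps_nth (fls_nth F n) i) * (l ^ i * \<rho> powi n) \<le> C" for n i
  proof -
    have "absv (fps_nth (fls_nth F n) i) * l ^ i \<le> gauss_norm absv l (fls_nth F n)"
      using gauss_norm_upper[OF disc[of "- n"], of l i] l assms by (simp add: eta_coeff_def)
    hence "absv (fps_nth (fls_nth F n) i) * l ^ i * \<rho> powi n \<le> gauss_norm absv l (fls_nth F n) * \<rho> powi n"
      using assms by (intro mult_right_mono) (auto intro: zero_le_power_int)
    also have "\<dots> \<le> C" using C[of "- n"] by (simp add: eta_coeff_def)
    finally show ?thesis by (simp add: mult.assoc)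
  qed
  thus ?thesis by (auto simp: op_bound_def)
qed

lemma op_bound_coeff:
  assumes "op_bound absv l \<rho> F C" "0 < \<rho>"
  shows "absv (fps_nth (fls_nth F n) i) * l ^ i \<le> C / \<rho> powi n"
  using op_boundD[OF assms(1), of n i] assms(2) by (simp add: field_simps)

lemma microdiff_opsI:
  assumes bound: "\<And>l \<rho>. 0 < l \<Longrightarrow> l < 1 \<Longrightarrow> 0 < \<rho> \<Longrightarrow> \<rho> < omega p * l \<Longrightarrow> \<exists>C. op_bound absv l \<rho> F C"
  shows "F \<in> microdiff_ops p absv"
proof -
  have disc: "eta_coeff F j \<in> disc_series absv" for j
  proof (rule disc_seriesI)
    fix l :: real assume l: "0 < l" "l < 1"
    \<comment> \<open>Any admissible \<rho> would do, since for a fixed power of \<eta> the weight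
      in \<rho> is a constant.\<close>
    then obtain C where "op_bound absv l (omega p * l / 2) F C"
      using bound[of l "omega p * l / 2"] omega_pos by auto
    thus "\<exists>C. \<forall>i. absv (fps_nth (eta_coeff F j) i) * l ^ i \<le> C"
      using op_bound_coeff[of l "omega p * l / 2" F C "- j"] omega_pos l by (auto simp: eta_coeff_def)
  qed
  have "Limsup at_bot (\<lambda>j. ereal (gauss_norm absv l (eta_coeff F j) * \<rho> powi (- j))) = 0"
    if "0 < \<rho>" "\<rho> < omega p * l" "omega p * l < omega p" for l \<rho>
  proof -
    \<comment> \<open>A larger radius still below \<open>omega p * l\<close>, as needed for
      \<open>bounded_imp_Limsup_zero\<close>.\<close>
    define \<rho>' where "\<rho>' = (\<rho> + omega p * l) / 2"
    have \<rho>': "\<rho> < \<rho>'" "\<rho>' < omega p * l" using that by (simp_all add: \<rho>'_def field_simps)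
    have l: "0 < l" "l < 1"
      using zero_less_mult_pos[OF less_trans[OF that(1,2)] omega_pos] that(3) omega_pos by simp_all
    have "0 < \<rho>'" using that(1) \<rho>'(1) by simp
    then obtain C where C: "op_bound absv l \<rho>' F C" using bound[OF l _ \<rho>'(2)] by blast
    show ?thesis
    proof (rule bounded_imp_Limsup_zero[OF that(1) \<rho>'(1)])
      fix j
      show "0 \<le> gauss_norm absv l (eta_coeff F j)" using gauss_norm_nonneg[OF disc l] .
      have "gauss_norm absv l (eta_coeff F j) \<le> C / \<rho>' powi (- j)"
        using op_bound_coeff[OF C, of "- j"] that \<rho>' by (intro gauss_norm_least) (auto simp: eta_coeff_def)
      thus "gauss_norm absv l (eta_coeff F j) * \<rho>' powi (- j) \<le> C"
        using that \<rho>' by (simp add: pos_le_divide_eq zero_less_power_int)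
    qed
  qed
  thus ?thesis using disc by (auto simp: microdiff_ops_def)
qed

text \<open>Without t the norms do not depend on \<open>l\<close>, and a \<rho> lies below
  \<open>omega p\<close> exactly if it lies below \<open>omega p * l\<close> for some
  \<open>l < 1\<close>.\<close>

lemma const_coeff_ops_iff:
  "F \<in> const_coeff_ops p absv \<longleftrightarrow>
     F \<in> microdiff_ops p absv \<and> (\<forall>n i. 0 < i \<longrightarrow> fps_nth (fls_nth F n) i = 0)"
proof safe
  assume "F \<in> const_coeff_ops p absv"
  then obtain a where a: "\<And>j. eta_coeff F j = fps_const (a j)"
    "\<And>\<rho>. 0 < \<rho> \<Longrightarrow> \<rho> < omega p \<Longrightarrow> Limsup at_bot (\<lambda>j. ereal (absv (a j) * \<rho> powi (- j))) = 0"
    by (auto simp: const_coeff_ops_def)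
  have F: "fls_nth F n = fps_const (a (- n))" for n
    using a(1)[of "- n"] by (simp add: eta_coeff_def)
  show "fps_nth (fls_nth F n) i = 0" if "0 < i" for n i using that F by simp
  show "F \<in> microdiff_ops p absv"
  proof (rule microdiff_opsI)
    fix l \<rho> :: real assume l: "0 < l" "l < 1" "0 < \<rho>" "\<rho> < omega p * l"
    have "omega p * l < omega p * 1" using l omega_pos by (intro mult_strict_left_mono) auto
    hence lim: "Limsup at_bot (\<lambda>j. ereal (absv (a j) * \<rho> powi (- j))) = 0"
      using a(2) l by simp
    have "absv (a j) * \<rho> powi (- j) = 0" if "j > - fls_subdegree F" for j
      using that F[of "- j"] by simp
    then obtain C where C: "\<And>j. absv (a j) * \<rho> powi (- j) \<le> C"
      using Limsup_zero_imp_bounded[OF _ lim] by blast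
    have "0 \<le> C" using C[of 0] absv_nonneg[of "a 0"] by simp
    have "absv (fps_nth (fls_nth F n) i) * (l ^ i * \<rho> powi n) \<le> C" for n i
      using C[of "- n"] \<open>0 \<le> C\<close> by (cases "i = 0") (simp_all add: F)
    thus "\<exists>C. op_bound absv l \<rho> F C"
      by (auto simp: op_bound_def)
  qed
next
  assume F: "F \<in> microdiff_ops p absv" "\<forall>n i. 0 < i \<longrightarrow> fps_nth (fls_nth F n) i = 0"
  define a where "a j = fps_nth (eta_coeff F j) 0" for j
  have "Limsup at_bot (\<lambda>j. ereal (absv (a j) * \<rho> powi (- j))) = 0" if \<rho>: "0 < \<rho>" "\<rho> < omega p" for \<rho>
  proof -
    define \<rho>' where "\<rho>' = (\<rho> + omega p) / 2"
    have \<rho>': "\<rho> < \<rho>'" "\<rho>' < omega p" using \<rho> by (auto simp: \<rho>'_def)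
    have "\<rho>' / omega p < 1" using \<rho>' omega_pos by simp
    then obtain l where l: "\<rho>' / omega p < l" "l < 1" using dense by blast
    hence "\<rho>' < omega p * l" using omega_pos by (simp add: pos_divide_less_eq mult.commute)
    then obtain C where "op_bound absv l \<rho>' F C"
      using microdiff_ops_op_bound[OF F(1) less_trans[OF \<rho>(1) \<rho>'(1)]] l by blast
    hence "absv (a j) * \<rho>' powi (- j) \<le> C" for j
      using op_boundD[of absv l \<rho>' F C "- j" 0] by (simp add: a_def eta_coeff_def)
    thus ?thesis by (rule bounded_imp_Limsup_zero[OF \<rho>(1) \<rho>'(1) absv_nonneg])
  qed
  moreover have "eta_coeff F j = fps_const (a j)" for j
    by (rule fps_ext) (simp add: F(2) a_def eta_coeff_def)
  ultimately show "F \<in> const_coeff_ops p absv"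
    unfolding const_coeff_ops_def by blast
qed

section \<open>Behaviour of the bounds under differences and products\<close>

lemma op_bound_diff:
  assumes "op_bound absv l \<rho> F C" "op_bound absv l \<rho> G C" "0 < l" "0 < \<rho>"
  shows "op_bound absv l \<rho> (F - G) C"
  unfolding op_bound_def
proof (intro allI)
  fix n i
  let ?w = "l ^ i * \<rho> powi n"
  have "0 \<le> ?w" using assms by (auto intro: zero_le_power_int)
  \<comment> \<open>A maximum instead of a sum: the constant stays \<open>C\<close> however often
    differences are taken.\<close>
  hence "absv (fps_nth (fls_nth (F - G) n) i) * ?w
      \<le> max (absv (fps_nth (fls_nth F n) i)) (absv (fps_nth (fls_nth G n) i)) * ?w"
    using absv_ultrametric[of "fps_nth (fls_nth F n) i" "- fps_nth (fls_nth G n) i"]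
    by (intro mult_right_mono) auto
  also have "\<dots> \<le> C"
    using op_boundD[OF assms(1), of n i] op_boundD[OF assms(2), of n i] by (simp add: max_def)
  finally show "absv (fps_nth (fls_nth (F - G) n) i) * ?w \<le> C" .
qed

lemma op_bound_mult:
  assumes "op_bound absv l \<rho> F C" "op_bound absv l \<rho> G D" "0 < l" "0 < \<rho>"
  shows "op_bound absv l \<rho> (F * G) (C * D)"
  unfolding op_bound_def
proof (intro allI)
  fix n i
  have nonneg: "0 \<le> C" "0 \<le> D" using assms op_bound_nonneg by blast+
  have "absv (\<Sum>k=fls_subdegree F..n - fls_subdegree G. \<Sum>j=0..i.
            fps_nth (fls_nth F k) j * fps_nth (fls_nth G (n - k)) (i - j)) * (l ^ i * \<rho> powi n) \<le> C * D"
  proof (intro absv_sum_weighted)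
    fix k j assume "j \<in> {0..i}"
    hence w: "l ^ i * \<rho> powi n = (l ^ j * \<rho> powi k) * (l ^ (i - j) * \<rho> powi (n - k))"
      using assms by (simp add: power_int_diff flip: power_add)
    let ?x = "fps_nth (fls_nth F k) j" and ?y = "fps_nth (fls_nth G (n - k)) (i - j)"
    have "absv (?x * ?y) * (l ^ i * \<rho> powi n)
        = (absv ?x * (l ^ j * \<rho> powi k)) * (absv ?y * (l ^ (i - j) * \<rho> powi (n - k)))"
      unfolding w absv_mult by (simp only: mult_ac)
    also have "\<dots> \<le> C * D"
      using assms absv_nonneg nonneg
      by (intro mult_mono op_boundD) (auto intro!: mult_nonneg_nonneg zero_le_power_int)
    finally show "absv (?x * ?y) * (l ^ i * \<rho> powi n) \<le> C * D" .
  qed (use assms nonneg in \<open>auto intro: zero_le_power_int\<close>)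
  thus "absv (fps_nth (fls_nth (F * G) n) i) * (l ^ i * \<rho> powi n) \<le> C * D"
    by (simp add: fls_times_nth(2) fps_sum_nth fps_mult_nth)
qed

text \<open>The integer factor is harmless, and shifting the index by \<open>a\<close> contributes
  \<open>\<rho> ^ a\<close>.\<close>

lemma op_bound_deriv_eta_funpow:
  assumes "op_bound absv l \<rho> F C" "0 < l" "0 < \<rho>"
  shows "op_bound absv l \<rho> ((deriv_eta ^^ a) F) (\<rho> ^ a * C)"
  unfolding op_bound_def
proof (intro allI)
  fix n i
  define z where "z = (\<Prod>k<a. int k + 1 - n)"
  define x where "x = fps_nth (fls_nth F (n - int a)) i"
  have "fps_nth (fls_nth ((deriv_eta ^^ a) F) n) i = of_int z * x"
    unfolding fls_nth_deriv_eta_funpow z_def[symmetric] x_def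
    by (simp only: fps_of_int[symmetric] fps_mult_left_const_nth)
  hence "absv (fps_nth (fls_nth ((deriv_eta ^^ a) F) n) i) * (l ^ i * \<rho> powi n)
      = absv (of_int z) * (absv x * (l ^ i * \<rho> powi n))"
    by (simp add: absv_mult)
  also have "\<dots> \<le> 1 * (absv x * (l ^ i * \<rho> powi n))"
    using absv_of_int assms absv_nonneg
    by (intro mult_right_mono) (auto intro!: mult_nonneg_nonneg zero_le_power_int)
  also have "\<dots> = \<rho> ^ a * (absv x * (l ^ i * \<rho> powi (n - int a)))"
    using assms by (simp add: power_int_diff)
  also have "\<dots> \<le> \<rho> ^ a * C"
    using op_boundD[OF assms(1), of "n - int a" i] assms by (simp add: x_def)
  finally show "absv (fps_nth (fls_nth ((deriv_eta ^^ a) F) n) i) * (l ^ i * \<rho> powi n) \<le> \<rho> ^ a * C" .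
qed

text \<open>Together with 1/a! the derivative has binomial coefficients as factors, so only the
  shift by \<open>a\<close> in the degree is paid for, by \<open>1 / l ^ a\<close>.\<close>

lemma op_bound_deriv_t_funpow:
  assumes "op_bound absv l \<rho> G D" "0 < l" "0 < \<rho>"
  shows "op_bound absv l \<rho> (fls_const (fps_const (1 / fact a)) * (deriv_t ^^ a) G) (D / l ^ a)"
  unfolding op_bound_def
proof (intro allI)
  fix n i
  let ?H = "fls_const (fps_const (1 / fact a)) * (deriv_t ^^ a) G"
  define x where "x = fps_nth (fls_nth G n) (i + a)"
  have "fps_nth (fls_nth ?H n) i = of_nat ((i + a) choose a) * x"
    by (simp add: fls_nth_deriv_t_pow fps_nth_deriv_funpow x_def)
  hence "absv (fps_nth (fls_nth ?H n) i) * (l ^ i * \<rho> powi n)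
      = absv (of_nat ((i + a) choose a)) * (absv x * (l ^ i * \<rho> powi n))"
    by (simp add: absv_mult)
  also have "\<dots> \<le> 1 * (absv x * (l ^ i * \<rho> powi n))"
    using absv_of_nat assms absv_nonneg
    by (intro mult_right_mono) (auto intro!: mult_nonneg_nonneg zero_le_power_int)
  also have "\<dots> = (absv x * (l ^ (i + a) * \<rho> powi n)) / l ^ a"
    using assms by (simp add: power_add)
  also have "\<dots> \<le> D / l ^ a"
    using op_boundD[OF assms(1), of n "i + a"] assms by (intro divide_right_mono) (auto simp: x_def)
  finally show "absv (fps_nth (fls_nth ?H n) i) * (l ^ i * \<rho> powi n) \<le> D / l ^ a" .
qed

text \<open>Summand \<open>a\<close> is bounded by \<open>(\<rho> / l) ^ a * (C * D)\<close>, and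
  \<rho> does not exceed \<open>l\<close>.\<close>

lemma op_bound_op_mult:
  assumes "op_bound absv l \<rho> F C" "op_bound absv l \<rho> G D" "0 < l" "0 < \<rho>" "\<rho> \<le> l"
  shows "op_bound absv l \<rho> (F \<odot> G) (C * D)"
proof -
  have nonneg: "0 \<le> C" "0 \<le> D" using assms op_bound_nonneg by blast+
  have summand: "op_bound absv l \<rho> (op_mult_summand F G a) (C * D)" for a
  proof (rule op_bound_mono)
    have "op_mult_summand F G a = (deriv_eta ^^ a) F * (fls_const (fps_const (1 / fact a)) * (deriv_t ^^ a) G)"
      by (simp add: op_mult_summand_def mult.left_commute)
    thus "op_bound absv l \<rho> (op_mult_summand F G a) ((\<rho> ^ a * C) * (D / l ^ a))"
      using assms by (simp only:) (intro op_bound_mult op_bound_deriv_eta_funpow op_bound_deriv_t_funpow)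
    have "(\<rho> ^ a * C) * (D / l ^ a) = (\<rho> / l) ^ a * (C * D)"
      by (simp add: power_divide)
    also have "\<dots> \<le> 1 * (C * D)"
      using assms nonneg by (intro mult_right_mono power_le_one) auto
    finally show "(\<rho> ^ a * C) * (D / l ^ a) \<le> C * D" by simp
  qed
  show ?thesis unfolding op_bound_def
  proof (intro allI)
    fix n i
    obtain N where N: "fls_nth (F \<odot> G) n = (\<Sum>a\<le>N. fls_nth (op_mult_summand F G a) n)"
      using fls_nth_op_mult_ev by blast
    show "absv (fps_nth (fls_nth (F \<odot> G) n) i) * (l ^ i * \<rho> powi n) \<le> C * D"
      unfolding N fps_sum_nth
      by (intro absv_sum_weighted op_boundD summand)
         (use nonneg assms in \<open>auto intro: zero_le_power_int\<close>)
  qed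
qed


text \<open>An invertible series has constant Gauss norm: the product of the first coefficients
  of \<open>b\<close> and \<open>c\<close> attaining the Gauss norms dominates its coefficient of \<open>b * c\<close>,
  which must therefore be the constant one.\<close>

lemma disc_series_first_maximal_coeff:
  assumes "a \<in> disc_series absv" "0 < l" "l < 1" "a \<noteq> 0"
  obtains i where "\<And>j. absv (fps_nth a j) * l ^ j \<le> absv (fps_nth a i) * l ^ i"
    "\<And>j. j < i \<Longrightarrow> absv (fps_nth a j) * l ^ j < absv (fps_nth a i) * l ^ i"
    "fps_nth a i \<noteq> 0"
proof -
  define h where "h i = absv (fps_nth a i) * l ^ i" for i
  obtain k where k: "fps_nth a k \<noteq> 0" using assms(4) by (auto simp: fps_eq_iff)
  hence hk: "h k > 0"
    using absv_pos assms by (simp add: h_def)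
  have "h \<longlonglongrightarrow> 0"
    using assms by (simp add: disc_series_def h_def[abs_def])
  hence "eventually (\<lambda>i. h i < h k) sequentially"
    using hk by (rule order_tendstoD)
  then obtain N where N: "\<And>i. i \<ge> N \<Longrightarrow> h i < h k"
    by (auto simp: eventually_sequentially)
  \<comment> \<open>Beyond \<open>N\<close> all terms are below \<open>h k\<close>, so including
    \<open>k\<close> makes this finite maximum a global one.\<close>
  define M where "M = Max (h ` {..max N k})"
  have le: "h j \<le> M" for j
  proof (cases "j \<le> max N k")
    case False
    hence "h j < h k" using N by simp
    also have "h k \<le> M" unfolding M_def by (intro Max_ge) auto
    finally show ?thesis by simp
  qed (auto simp: M_def)
  have "M \<in> h ` {..max N k}" unfolding M_def by (intro Max_in) auto
  hence ex: "\<exists>i. h i = M" by auto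
  define i where "i = (LEAST i. h i = M)"
  have i: "h i = M" unfolding i_def using LeastI_ex[OF ex] .
  have "h j < M" if "j < i" for j
    using that not_less_Least[of j "\<lambda>i. h i = M"] le[of j] by (auto simp: i_def)
  moreover have "fps_nth a i \<noteq> 0"
    using hk le[of k] i by (auto simp: h_def)
  ultimately show ?thesis using that[of i] le i by (auto simp: h_def)
qed

lemma invertible_disc_series_coeff_le:
  assumes b: "b \<in> disc_series absv" and c: "c \<in> disc_series absv" and bc: "b * c = 1"
    and l: "0 < l" "l < 1"
  shows "absv (fps_nth b i) * l ^ i \<le> absv (fps_nth b 0)"
proof -
  define f where "f i = absv (fps_nth b i) * l ^ i" for i
  define g where "g i = absv (fps_nth c i) * l ^ i" for i
  obtain i0 where i0: "\<And>j. f j \<le> f i0" "\<And>j. j < i0 \<Longrightarrow> f j < f i0" "fps_nth b i0 \<noteq> 0"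
    using disc_series_first_maximal_coeff[OF b l] bc unfolding f_def by (metis mult_zero_left zero_neq_one)
  obtain j0 where j0: "\<And>j. g j \<le> g j0" "\<And>j. j < j0 \<Longrightarrow> g j < g j0" "fps_nth c j0 \<noteq> 0"
    using disc_series_first_maximal_coeff[OF c l] bc unfolding g_def by (metis mult_zero_right zero_neq_one)
  have nonneg: "0 \<le> f i" "0 \<le> g i" for i
    using absv_nonneg l by (auto simp: f_def g_def)
  have pos: "0 < f i0" "0 < g j0"
    using i0(3) j0(3) l absv_pos by (auto simp: f_def g_def)
  define n where "n = i0 + j0"
  define t where "t k = fps_nth b k * fps_nth c (n - k)" for k
  have t: "absv (t k) * l ^ n = f k * g (n - k)" if "k \<le> n" for k
    using that by (simp add: t_def f_def g_def absv_mult flip: power_add)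
  \<comment> \<open>Away from \<open>i0\<close>, either \<open>k\<close> precedes the first maximum
    of \<open>f\<close> or \<open>n - k\<close> precedes that of \<open>g\<close>.\<close>
  have strict: "absv (t k) * l ^ n < f i0 * g j0" if "k \<in> {0..n} - {i0}" for k
  proof (cases "k < i0")
    case True
    have "f k * g (n - k) \<le> f k * g j0" using nonneg j0 by (intro mult_left_mono) auto
    also have "\<dots> < f i0 * g j0" using i0(2)[OF True] pos by simp
    finally show ?thesis using t[of k] that by simp
  next
    case False
    hence "n - k < j0" using that by (auto simp: n_def)
    have "f k * g (n - k) \<le> f i0 * g (n - k)" using nonneg i0 by (intro mult_right_mono) auto
    also have "\<dots> < f i0 * g j0" using j0(2)[OF \<open>n - k < j0\<close>] pos by simp
    finally show ?thesis using t[of k] that by simp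
  qed
  define rest where "rest = sum t ({0..n} - {i0})"
  \<comment> \<open>The strict inequality passes to the sum through its largest term; an empty sum
    needs positivity instead.\<close>
  have rest: "absv rest * l ^ n < f i0 * g j0"
  proof (cases "{0..n} - {i0} = {}")
    case True
    hence "rest = 0" unfolding rest_def by (simp only: sum.empty)
    thus ?thesis using pos by simp
  next
    case False
    define C where "C = Max ((\<lambda>k. absv (t k) * l ^ n) ` ({0..n} - {i0}))"
    have "C \<in> (\<lambda>k. absv (t k) * l ^ n) ` ({0..n} - {i0})"
      unfolding C_def using False by (intro Max_in) auto
    then obtain k where k: "k \<in> {0..n} - {i0}" "C = absv (t k) * l ^ n" by blast
    have "absv rest * l ^ n \<le> C"
      unfolding rest_def
    proof (rule absv_sum_weighted)
      show "absv (t k) * l ^ n \<le> C" if "k \<in> {0..n} - {i0}" for k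
        unfolding C_def using that by (intro Max_ge) auto
    qed (use k(2) l absv_nonneg in auto)
    thus ?thesis using strict[OF k(1)] k(2) by simp
  qed
  have "fps_nth (b * c) n = t i0 + rest"
    unfolding fps_mult_nth rest_def t_def by (subst sum.remove[of _ i0]) (auto simp: n_def)
  hence "n = 0"
  proof (rule contrapos_pp)
    assume "n \<noteq> 0"
    hence "fps_nth (b * c) n = 0" by (simp add: bc)
    moreover have "t i0 + rest \<noteq> 0"
    proof
      assume "t i0 + rest = 0"
      hence "absv (t i0) = absv rest" by (metis absv_minus add_eq_0_iff)
      thus False using rest t[of i0] by (simp add: n_def)
    qed
    ultimately show "fps_nth (b * c) n \<noteq> t i0 + rest" by simp
  qed
  hence "i0 = 0" by (simp add: n_def)
  thus ?thesis using i0(1)[of i] by (simp add: f_def)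
qed

text \<open>Dominance equates the leading term with the supremum \<open>op_norm\<close>. Membership
  in the operator ring bounds the family, so this supremum really bounds all coefficients.\<close>

lemma op_bound_dominant:
  assumes F: "F \<in> microdiff_ops p absv" "dominant p absv F"
  obtains l0 where "l0 < 1"
    "\<And>l \<rho>. l0 < l \<Longrightarrow> l < 1 \<Longrightarrow> 0 < \<rho> \<Longrightarrow> \<rho> < omega p * l \<Longrightarrow>
       op_bound absv l \<rho> F (gauss_norm absv l (fls_nth F (fls_subdegree F)) * \<rho> powi fls_subdegree F)"
proof -
  obtain l0 where l0: "l0 < 1" "\<And>l \<rho>. l0 < l \<Longrightarrow> l < 1 \<Longrightarrow> 0 < \<rho> \<Longrightarrow> \<rho> < omega p * l \<Longrightarrow>
      gauss_norm absv l (fls_nth F (fls_subdegree F)) * \<rho> powi fls_subdegree F = op_norm absv l \<rho> F"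
    using F(2) by (auto simp: dominant_def op_ord_def eta_coeff_def)
  have disc: "fls_nth F n \<in> disc_series absv" for n
    using F(1) by (auto simp: microdiff_ops_def eta_coeff_def dest: spec[of _ "- n"])
  have "op_bound absv l \<rho> F (gauss_norm absv l (fls_nth F (fls_subdegree F)) * \<rho> powi fls_subdegree F)"
    if l: "l0 < l" "l < 1" "0 < \<rho>" "\<rho> < omega p * l" for l \<rho>
    unfolding l0(2)[OF l] op_bound_def
  proof (intro allI)
    fix n i
    have "0 < l" using zero_less_mult_pos[OF less_trans[OF l(3,4)] omega_pos] .
    have \<rho>: "0 < \<rho> powi n" for n using l by (simp add: zero_less_power_int)
    obtain C where C: "op_bound absv l \<rho> F C"
      using microdiff_ops_op_bound[OF F(1) l(3,4,2)] by blast
    have "gauss_norm absv l (eta_coeff F u) * \<rho> powi (- u) \<le> C" for u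
    proof -
      have "gauss_norm absv l (eta_coeff F u) \<le> C / \<rho> powi (- u)"
        using op_bound_coeff[OF C l(3), of "- u"] by (intro gauss_norm_least) (simp add: eta_coeff_def)
      thus ?thesis using \<rho>[of "- u"] by (simp only: pos_le_divide_eq)
    qed
    hence bdd: "bdd_above (range (\<lambda>u. gauss_norm absv l (eta_coeff F u) * \<rho> powi (- u)))"
      by (auto simp: bdd_above_def)
    have "absv (fps_nth (fls_nth F n) i) * l ^ i * \<rho> powi n \<le> gauss_norm absv l (fls_nth F n) * \<rho> powi n"
      using gauss_norm_upper[OF disc \<open>0 < l\<close> l(2)] \<rho>[of n] by (intro mult_right_mono) auto
    also have "\<dots> \<le> op_norm absv l \<rho> F"
      using cSUP_upper[OF _ bdd, of "- n"] by (simp add: op_norm_def eta_coeff_def)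
    finally show "absv (fps_nth (fls_nth F n) i) * (l ^ i * \<rho> powi n) \<le> op_norm absv l \<rho> F"
      by (simp add: mult.assoc)
  qed
  thus ?thesis using l0(1) that by blast
qed

lemma weighted_mult_le:
  assumes "\<And>i. absv (fps_nth f i) * l ^ i \<le> C" "\<And>i. absv (fps_nth g i) * l ^ i \<le> D" "0 < l"
  shows "absv (fps_nth (f * g) i) * l ^ i \<le> C * D"
proof -
  have nonneg: "0 \<le> C" "0 \<le> D"
    using assms(1)[of 0] assms(2)[of 0] absv_nonneg[of "fps_nth f 0"] absv_nonneg[of "fps_nth g 0"] by auto
  have "absv (\<Sum>j=0..i. fps_nth f j * fps_nth g (i - j)) * l ^ i \<le> C * D"
  proof (rule absv_sum_weighted)
    fix j assume "j \<in> {0..i}"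
    hence "absv (fps_nth f j * fps_nth g (i - j)) * l ^ i
        = (absv (fps_nth f j) * l ^ j) * (absv (fps_nth g (i - j)) * l ^ (i - j))"
      by (simp add: absv_mult flip: power_add)
    also have "\<dots> \<le> C * D"
      using assms nonneg absv_nonneg by (intro mult_mono) auto
    finally show "absv (fps_nth f j * fps_nth g (i - j)) * l ^ i \<le> C * D" .
  qed (use assms nonneg in auto)
  thus ?thesis by (simp add: fps_mult_nth)
qed

section \<open>Existence of the quotient\<close>

lemma division_exists:
  assumes F: "F \<in> microdiff_ops p absv" "dominant p absv F"
    and b: "b \<in> disc_series absv" and c: "c \<in> disc_series absv" and bc: "b * c = 1"
    and symbol: "fls_nth F (fls_subdegree F) = fps_X ^ m * b"
    and G: "G \<in> microdiff_ops p absv"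
  obtains Q where "Q \<in> microdiff_ops p absv" "G - Q \<odot> F \<in> microdiff_ops p absv"
    "\<And>n i. m \<le> i \<Longrightarrow> fps_nth (fls_nth (G - Q \<odot> F) n) i = 0"
proof -
  have cb: "c * b = 1" using bc by (simp add: mult.commute)
  define s where "s = fls_subdegree F"
  define d where "d = fls_subdegree G"
  \<comment> \<open>Index of the first quotient coefficient, the one of \<eta>^(ord G - ord
    F).\<close>
  define e where "e = d - s"
  \<comment> \<open>Division by \<open>t^m * b\<close>: the shift discards the part of degree below
    \<open>m\<close>, which stays in the remainder, and \<open>c\<close> inverts
    \<open>b\<close>.\<close>
  define quot where "quot g = c * fps_shift m g" for g
  \<comment> \<open>Partial quotients. Stage \<open>k\<close> treats index \<open>d + k\<close> of
    the current remainder with a monomial at index \<open>e + k\<close>.\<close>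
  define QQ where "QQ = rec_nat 0 (\<lambda>k P. P + eta_monom (quot (fls_nth (G - P \<odot> F) (d + int k))) (- (e + int k)))"
  define q where "q k = quot (fls_nth (G - QQ k \<odot> F) (d + int k))" for k
  define M where "M k = eta_monom (q k) (- (e + int k))" for k
  have QQ_0: "QQ 0 = 0" and QQ_Suc: "QQ (Suc k) = QQ k + M k" for k
    by (simp_all add: QQ_def M_def q_def)
  define Q where "Q = Abs_fls (\<lambda>n. if n < e then 0 else q (nat (n - e)))"
  have Q: "fls_nth Q n = (if n < e then 0 else q (nat (n - e)))" for n
    unfolding Q_def by (rule nth_Abs_fls_lower_bound[of e]) auto
  have QQ: "fls_nth (QQ k) n = (if n < e + int k then fls_nth Q n else 0)" for k n
  proof (induction k)
    case 0
    thus ?case by (simp add: QQ_0 Q)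
  next
    case (Suc k)
    thus ?case by (auto simp: QQ_Suc M_def fls_nth_eta_monom Q)
  qed
  have F_low: "fls_nth F n = 0" if "n < s" for n using that by (simp add: s_def)
  have M_low: "fls_nth (M k) n = 0" if "n < e + int k" for k n
    using that by (simp add: M_def fls_nth_eta_monom)
  define D where "D k = G - QQ k \<odot> F" for k
  have D_0: "D 0 = G" by (simp add: D_def QQ_0)
  have D_Suc: "D (Suc k) = D k - M k \<odot> F" for k
    by (simp add: D_def QQ_Suc op_mult_add_left)
  \<comment> \<open>\<open>Q - QQ k\<close> starts at \<open>e + k\<close>, so its product with
    \<open>F\<close> starts at \<open>d + k\<close>: earlier coefficients are final after
    \<open>k\<close> stages.\<close>
  have D_eq: "fls_nth (G - Q \<odot> F) n = fls_nth (D k) n" if "n < d + int k" for n k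
  proof -
    have "fls_nth ((Q - QQ k) \<odot> F) n = 0"
      by (rule op_mult_eq_0_below[of "e + int k" _ s]) (use that F_low in \<open>auto simp: QQ e_def\<close>)
    thus ?thesis by (simp add: D_def op_mult_diff_left)
  qed
  have low: "fps_nth (fls_nth (G - Q \<odot> F) n) i = 0" if "m \<le> i" for n i
  proof (cases "n < d")
    case True
    thus ?thesis using D_eq[of n 0] by (simp add: D_0 d_def)
  next
    case False
    define k where "k = nat (n - d)"
    have n: "n = d + int k" using False by (simp add: k_def)
    \<comment> \<open>At its lowest index, \<open>M k \<odot> F\<close> reproduces exactly the part
      of degree at least \<open>m\<close> of the current coefficient, so subtracting it removes that
      part.\<close>
    have "fls_nth (M k \<odot> F) n = fls_nth (M k) (e + int k) * fls_nth F s"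
      using op_mult_lowest[of "e + int k" "M k" s F] M_low F_low by (simp add: n e_def)
    also have "\<dots> = (b * c) * (fps_X ^ m * fps_shift m (fls_nth (D k) n))"
      by (simp add: M_def fls_nth_eta_monom q_def quot_def D_def n s_def symbol algebra_simps)
    finally have "fps_nth (fls_nth (M k \<odot> F) n) i = fps_nth (fls_nth (D k) n) i"
      using that by (simp add: bc fps_X_power_mult_nth)
    thus ?thesis using D_eq[of n "Suc k"] by (simp add: n D_Suc)
  qed
  obtain l0 where l0: "l0 < 1" "\<And>l \<rho>. l0 < l \<Longrightarrow> l < 1 \<Longrightarrow> 0 < \<rho> \<Longrightarrow> \<rho> < omega p * l \<Longrightarrow>
       op_bound absv l \<rho> F (gauss_norm absv l (fls_nth F s) * \<rho> powi s)"
    using op_bound_dominant[OF F] unfolding s_def by blast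
  \<comment> \<open>Radii close to 1 first, where dominance applies; \<open>0 < l\<close> is
    separate because \<open>l0\<close> may be negative.\<close>
  have bounds: "(\<exists>C. op_bound absv l \<rho> Q C) \<and> (\<exists>C. op_bound absv l \<rho> (G - Q \<odot> F) C)"
    if l: "l0 < l" "l < 1" "0 < l" and \<rho>: "0 < \<rho>" "\<rho> < omega p * l" for l \<rho>
  proof -
    have "omega p * l \<le> 1 * l" using l omega_le_1 by (intro mult_right_mono) auto
    hence "\<rho> \<le> l" using \<rho> by simp
    \<comment> \<open>The norm of the leading term of \<open>F\<close>, as the Gauss norm of the
      invertible \<open>b\<close> is \<open>absv (fps_nth b 0)\<close>.\<close>
    define N where "N = l ^ m * absv (fps_nth b 0) * \<rho> powi s"
    have bc0: "absv (fps_nth b 0) * absv (fps_nth c 0) = 1"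
      using arg_cong[OF bc, of "\<lambda>f. absv (fps_nth f 0)"] by (simp add: absv_mult)
    hence "fps_nth b 0 \<noteq> 0" by auto
    hence b0: "0 < absv (fps_nth b 0)" by (rule absv_pos)
    have N: "0 < N" using b0 l \<rho> by (simp add: N_def zero_less_power_int)
    have F_bound: "op_bound absv l \<rho> F N"
    proof (rule op_bound_mono[OF l0(2)[OF l(1,2) \<rho>]])
      have "gauss_norm absv l (fls_nth F s) \<le> l ^ m * absv (fps_nth b 0)"
      proof (rule gauss_norm_least)
        fix i
        show "absv (fps_nth (fls_nth F s) i) * l ^ i \<le> l ^ m * absv (fps_nth b 0)"
        proof (cases "i < m")
          case True
          thus ?thesis using l b0 by (simp add: symbol s_def fps_X_power_mult_nth)
        next
          case False
          hence "l ^ i = l ^ m * l ^ (i - m)"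
            by (simp flip: power_add)
          moreover have "fps_nth (fls_nth F s) i = fps_nth b (i - m)"
            using False by (simp add: symbol s_def fps_X_power_mult_nth)
          ultimately have "absv (fps_nth (fls_nth F s) i) * l ^ i = l ^ m * (absv (fps_nth b (i - m)) * l ^ (i - m))"
            by (simp only: mult.left_commute)
          also have "\<dots> \<le> l ^ m * absv (fps_nth b 0)"
            using invertible_disc_series_coeff_le[OF b c bc l(3,2)] l by (intro mult_left_mono) auto
          finally show ?thesis .
        qed
      qed
      thus "gauss_norm absv l (fls_nth F s) * \<rho> powi s \<le> N"
        unfolding N_def using \<rho> by (intro mult_right_mono) (auto intro: zero_le_power_int)
    qed
    obtain C where C: "op_bound absv l \<rho> G C"
      using microdiff_ops_op_bound[OF G \<rho> l(2)] by blast
    \<comment> \<open>Dropping \<open>t^m\<close> costs \<open>1 / l ^ m\<close>, multiplying by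
      \<open>c\<close> costs \<open>absv (fps_nth c 0) = 1 / absv (fps_nth b 0)\<close>, and the
      change of index costs \<open>1 / \<rho> powi s\<close>: together exactly
      \<open>1 / N\<close>.\<close>
    have q: "absv (fps_nth (q k) i) * (l ^ i * \<rho> powi (e + int k)) \<le> C / N"
      if "op_bound absv l \<rho> (D k) C" for k i
    proof -
      define g where "g = fls_nth (D k) (d + int k)"
      have pow: "\<rho> powi (d + int k) = \<rho> powi (e + int k) * \<rho> powi s"
        using \<rho> by (simp add: e_def flip: power_int_add)
      have pos: "0 < \<rho> powi (e + int k)" "0 < \<rho> powi s" using \<rho> by (auto simp: zero_less_power_int)
      have g: "absv (fps_nth (fps_shift m g) i) * l ^ i \<le> C / \<rho> powi (d + int k) / l ^ m" for i
        using op_bound_coeff[OF that \<rho>(1), of "d + int k" "i + m"] l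
        by (simp only: g_def fps_shift_nth pos_le_divide_eq[OF zero_less_power] power_add mult.assoc)
      have "absv (fps_nth (q k) i) * l ^ i \<le> absv (fps_nth c 0) * (C / \<rho> powi (d + int k) / l ^ m)"
        unfolding q_def quot_def D_def[symmetric] g_def[symmetric]
        by (rule weighted_mult_le[OF invertible_disc_series_coeff_le[OF c b cb l(3,2)] g l(3)])
      also have "absv (fps_nth c 0) = 1 / absv (fps_nth b 0)"
        using bc0 b0 by (simp add: field_simps)
      also have "1 / absv (fps_nth b 0) * (C / \<rho> powi (d + int k) / l ^ m) = C / N / \<rho> powi (e + int k)"
        by (simp add: N_def pow mult_ac)
      finally show ?thesis using pos(1) by (simp only: pos_le_divide_eq mult.assoc)
    qed
    \<comment> \<open>Since \<open>M k\<close> is bounded by \<open>C / N\<close> and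
      \<open>F\<close> by \<open>N\<close>, the same \<open>C\<close> works at every stage.\<close>
    have D_bound: "op_bound absv l \<rho> (D k) C" for k
    proof (induction k)
      case (Suc k)
      have "0 \<le> C" using op_bound_nonneg[OF C] l \<rho> by blast
      hence "0 \<le> C / N" using N by simp
      hence "absv (fps_nth (fls_nth (M k) n) i) * (l ^ i * \<rho> powi n) \<le> C / N" for n i
        using q[OF Suc, of i] by (cases "n = e + int k") (simp_all add: M_def fls_nth_eta_monom)
      hence "op_bound absv l \<rho> (M k) (C / N)" by (simp add: op_bound_def)
      from op_bound_op_mult[OF this F_bound l(3) \<rho>(1) \<open>\<rho> \<le> l\<close>] N
      have "op_bound absv l \<rho> (M k \<odot> F) C" by simp
      thus ?case unfolding D_Suc using Suc l \<rho> by (intro op_bound_diff)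
    qed (use C D_0 in simp)
    have "op_bound absv l \<rho> Q (C / N)"
      unfolding op_bound_def
    proof (intro allI)
      fix n i
      show "absv (fps_nth (fls_nth Q n) i) * (l ^ i * \<rho> powi n) \<le> C / N"
      proof (cases "n < e")
        case True
        thus ?thesis using op_bound_nonneg[OF C l(3) \<rho>(1)] N by (simp add: Q)
      next
        case False
        thus ?thesis using q[OF D_bound, of "nat (n - e)" i] by (simp add: Q)
      qed
    qed
    moreover have "op_bound absv l \<rho> (G - Q \<odot> F) C"
      unfolding op_bound_def
    proof (intro allI)
      fix n i
      \<comment> \<open>The extra 1 gives the strict \<open>n < d + k\<close> of
        \<open>D_eq\<close>; \<open>nat\<close> returns stage 0 for indices below
        \<open>d\<close>.\<close>
      have "fls_nth (G - Q \<odot> F) n = fls_nth (D (nat (n - d + 1))) n"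
        by (rule D_eq) simp
      thus "absv (fps_nth (fls_nth (G - Q \<odot> F) n) i) * (l ^ i * \<rho> powi n) \<le> C"
        using op_boundD[OF D_bound[of "nat (n - d + 1)"], of n i] by simp
    qed
    ultimately show ?thesis by blast
  qed
  have "(\<exists>C. op_bound absv l \<rho> Q C) \<and> (\<exists>C. op_bound absv l \<rho> (G - Q \<odot> F) C)"
    if l: "0 < l" "l < 1" and \<rho>: "0 < \<rho>" "\<rho> < omega p * l" for l \<rho>
  proof -
    \<comment> \<open>A larger \<open>l'\<close> in the dominant range keeps \<rho> admissible, and
      its bounds descend to \<open>l\<close>.\<close>
    obtain l' where l': "max l l0 < l'" "l' < 1" using l l0(1) dense[of "max l l0" 1] by auto
    have "omega p * l \<le> omega p * l'" using l' omega_pos by (intro mult_left_mono) auto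
    hence "(\<exists>C. op_bound absv l' \<rho> Q C) \<and> (\<exists>C. op_bound absv l' \<rho> (G - Q \<odot> F) C)"
      using l' l \<rho> by (intro bounds) auto
    moreover have "l \<le> l'" using l' by simp
    ultimately show ?thesis
      using op_bound_mono_radius[OF _ l(1) _ \<rho>(1)] by blast
  qed
  hence "Q \<in> microdiff_ops p absv" "G - Q \<odot> F \<in> microdiff_ops p absv"
    by (auto intro!: microdiff_opsI)
  thus ?thesis using low by (rule that)
qed

section \<open>Constant coefficient operators\<close>

lemma microdiff_ops_diff:
  assumes "F \<in> microdiff_ops p absv" "G \<in> microdiff_ops p absv"
  shows "F - G \<in> microdiff_ops p absv"
proof (rule microdiff_opsI)
  fix l \<rho> :: real assume l: "0 < l" "l < 1" "0 < \<rho>" "\<rho> < omega p * l"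
  obtain C D where "op_bound absv l \<rho> F C" "op_bound absv l \<rho> G D"
    using microdiff_ops_op_bound[OF _ l(3,4,2)] assms by meson
  hence "op_bound absv l \<rho> (F - G) (max C D)"
    using l by (intro op_bound_diff op_bound_mono[of _ _ _ _ _ "max C D"]) auto
  thus "\<exists>C. op_bound absv l \<rho> (F - G) C" by blast
qed

lemma const_coeff_ops_coeff:
  "R \<in> const_coeff_ops p absv \<Longrightarrow> 0 < i \<Longrightarrow> fps_nth (fls_nth R n) i = 0"
  using const_coeff_ops_iff by blast

lemma const_coeff_ops_diff:
  "F \<in> const_coeff_ops p absv \<Longrightarrow> G \<in> const_coeff_ops p absv \<Longrightarrow> F - G \<in> const_coeff_ops p absv"
  unfolding const_coeff_ops_iff using microdiff_ops_diff[of F G] by auto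

text \<open>These are the correction terms of the Leibniz rule in
  \<open>const_op_mult_t_power\<close>.\<close>

lemma const_coeff_ops_scaled_deriv:
  assumes "F \<in> const_coeff_ops p absv"
  shows "fls_const (of_nat k) * (deriv_eta ^^ a) F \<in> const_coeff_ops p absv"
proof -
  have coeff: "fps_nth (fls_nth (fls_const (of_nat k) * (deriv_eta ^^ a) F) n) i
      = of_nat k * fps_nth (fls_nth ((deriv_eta ^^ a) F) n) i" for n i
    by (simp only: fls_mult_const_nth fps_nth_of_nat_mult)
  have "fls_const (of_nat k) * (deriv_eta ^^ a) F \<in> microdiff_ops p absv"
  proof (rule microdiff_opsI)
    fix l \<rho> :: real assume l: "0 < l" "l < 1" "0 < \<rho>" "\<rho> < omega p * l"
    obtain C where "op_bound absv l \<rho> F C"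
      using microdiff_ops_op_bound[OF _ l(3,4,2)] assms const_coeff_ops_iff by blast
    hence E: "op_bound absv l \<rho> ((deriv_eta ^^ a) F) (\<rho> ^ a * C)"
      using l by (intro op_bound_deriv_eta_funpow)
    have "absv (fps_nth (fls_nth (fls_const (of_nat k) * (deriv_eta ^^ a) F) n) i) * (l ^ i * \<rho> powi n)
        \<le> \<rho> ^ a * C" for n i
    proof -
      let ?x = "absv (fps_nth (fls_nth ((deriv_eta ^^ a) F) n) i) * (l ^ i * \<rho> powi n)"
      have "0 \<le> ?x" using l absv_nonneg by (intro mult_nonneg_nonneg) (auto intro: zero_le_power_int)
      hence "absv (of_nat k) * ?x \<le> ?x" using absv_of_nat by (intro mult_left_le_one_le) (auto simp: absv_nonneg)
      thus ?thesis using op_boundD[OF E, of n i] unfolding coeff absv_mult by (simp add: mult.assoc)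
    qed
    thus "\<exists>C. op_bound absv l \<rho> (fls_const (of_nat k) * (deriv_eta ^^ a) F) C"
      by (auto simp: op_bound_def)
  qed
  moreover have "fps_nth (fls_nth ((deriv_eta ^^ a) F) n) i = 0" if "0 < i" for n i
    using const_coeff_ops_coeff[OF assms that]
    by (simp only: fls_nth_deriv_eta_funpow fps_of_int[symmetric] fps_mult_left_const_nth mult_zero_right)
  ultimately show ?thesis by (simp add: const_coeff_ops_iff coeff)
qed

text \<open>Extracting the coefficient of \<open>t^k\<close> divides the bound by
  \<open>l ^ k\<close> only. Produces the remainder coefficients.\<close>

lemma const_coeff_ops_of_coeff:
  assumes "H \<in> microdiff_ops p absv"
  shows "\<exists>R\<in>const_coeff_ops p absv. \<forall>n. fps_nth (fls_nth R n) 0 = fps_nth (fls_nth H n) k"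
proof -
  define R where "R = Abs_fls (\<lambda>n. fps_const (fps_nth (fls_nth H n) k))"
  have R: "fls_nth R n = fps_const (fps_nth (fls_nth H n) k)" for n
    unfolding R_def by (rule nth_Abs_fls_lower_bound[of "fls_subdegree H"]) auto
  have "R \<in> microdiff_ops p absv"
  proof (rule microdiff_opsI)
    fix l \<rho> :: real assume l: "0 < l" "l < 1" "0 < \<rho>" "\<rho> < omega p * l"
    then obtain C where C: "op_bound absv l \<rho> H C"
      using microdiff_ops_op_bound[OF assms] by blast
    have nonneg: "0 \<le> C" using op_bound_nonneg[OF C] l by blast
    have "absv (fps_nth (fls_nth R n) i) * (l ^ i * \<rho> powi n) \<le> C / l ^ k" for n i
      using op_boundD[OF C, of n k] l nonneg by (cases "i = 0") (simp_all add: R field_simps)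
    thus "\<exists>C. op_bound absv l \<rho> R C" by (auto simp: op_bound_def)
  qed
  hence "R \<in> const_coeff_ops p absv" by (simp add: const_coeff_ops_iff R)
  thus ?thesis using R by (intro bexI[of _ R]) auto
qed

text \<open>The last coefficient is \<open>S m = R m\<close>, since moving \<open>t^m\<close> to the right of \<open>R m\<close>
  only produces terms of lower degree in \<open>t\<close>.\<close>

lemma right_form_exists:
  assumes "\<And>k. k < m \<Longrightarrow> R k \<in> const_coeff_ops p absv"
  shows "\<exists>S. (\<forall>k<m. S k \<in> const_coeff_ops p absv) \<and>
    (\<Sum>k<m. eta_monom (fps_X ^ k) 0 \<odot> R k) = (\<Sum>k<m. S k \<odot> eta_monom (fps_X ^ k) 0)"
  using assms
proof (induction m arbitrary: R)
  case (Suc m)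
  \<comment> \<open>The part subtracted is what \<open>R m \<odot> t^m\<close> contributes at
    \<open>t^k\<close> for \<open>k < m\<close>.\<close>
  define R' where "R' k = R k - fls_const (of_nat (m choose k)) * (deriv_eta ^^ (m - k)) (R m)" for k
  have R': "R' k \<in> const_coeff_ops p absv" if "k < m" for k
    unfolding R'_def using that Suc.prems by (intro const_coeff_ops_diff const_coeff_ops_scaled_deriv) auto
  then obtain S where S: "\<And>k. k < m \<Longrightarrow> S k \<in> const_coeff_ops p absv"
    "(\<Sum>k<m. eta_monom (fps_X ^ k) 0 \<odot> R' k) = (\<Sum>k<m. S k \<odot> eta_monom (fps_X ^ k) 0)"
    using Suc.IH[of R'] by blast
  have "(\<Sum>k<Suc m. eta_monom (fps_X ^ k) 0 \<odot> R k)
      = (\<Sum>k<m. eta_monom (fps_X ^ k) 0 \<odot> R' k) + R m \<odot> eta_monom (fps_X ^ m) 0"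
  proof (rule fls_eqI, rule fps_ext)
    fix n i
    have "fps_nth (fls_nth (R m \<odot> eta_monom (fps_X ^ m) 0) n) i = (if i \<le> m then
        of_nat (m choose i) * fps_nth (fls_nth ((deriv_eta ^^ (m - i)) (R m)) n) 0 else 0)"
      using Suc.prems const_coeff_ops_coeff by (intro const_op_mult_t_power) blast
    moreover have "fps_nth (fls_nth (\<Sum>k<Suc m. eta_monom (fps_X ^ k) 0 \<odot> R k) n) i
        = (if i < Suc m then fps_nth (fls_nth (R i) n) 0 else 0)"
      using Suc.prems const_coeff_ops_coeff by (intro fps_nth_t_power_sum) blast
    moreover have "fps_nth (fls_nth (\<Sum>k<m. eta_monom (fps_X ^ k) 0 \<odot> R' k) n) i
        = (if i < m then fps_nth (fls_nth (R' i) n) 0 else 0)"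
      using R' const_coeff_ops_coeff by (intro fps_nth_t_power_sum) blast
    moreover have "fps_nth (fls_nth (R' i) n) 0 = fps_nth (fls_nth (R i) n) 0
        - of_nat (m choose i) * fps_nth (fls_nth ((deriv_eta ^^ (m - i)) (R m)) n) 0"
      by (simp only: R'_def fls_minus_nth fps_sub_nth fls_mult_const_nth fps_nth_of_nat_mult)
    \<comment> \<open>Below \<open>m\<close> the corrections cancel; at \<open>m\<close> the
      derivative has order 0 and the binomial is 1; above \<open>m\<close> everything
      vanishes.\<close>
    ultimately show "fps_nth (fls_nth (\<Sum>k<Suc m. eta_monom (fps_X ^ k) 0 \<odot> R k) n) i
      = fps_nth (fls_nth ((\<Sum>k<m. eta_monom (fps_X ^ k) 0 \<odot> R' k) + R m \<odot> eta_monom (fps_X ^ m) 0) n) i"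
      by (cases "i < m"; cases "i = m") (simp_all del: sum.lessThan_Suc)
  qed
  also have "\<dots> = (\<Sum>k<Suc m. (S(m := R m)) k \<odot> eta_monom (fps_X ^ k) 0)"
    by (simp add: S(2))
  finally show ?case using S(1) Suc.prems by (intro exI[of _ "S(m := R m)"]) (auto simp: less_Suc_eq)
qed auto

text \<open>The system is triangular: \<open>S k \<odot> t^k\<close> has degree at most
  \<open>k\<close> in t, so the top power sees only the last \<open>S\<close>, which vanishes and
  drops out of the sum.\<close>

lemma right_form_eq_0:
  assumes "\<And>k. k < m \<Longrightarrow> S k \<in> const_coeff_ops p absv"
    and "(\<Sum>k<m. S k \<odot> eta_monom (fps_X ^ k) 0) = 0" "k < m"
  shows "S k = 0"
  using assms
proof (induction m arbitrary: k)
  case (Suc m)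
  have T: "fps_nth (fls_nth (S k \<odot> eta_monom (fps_X ^ k) 0) n) i = (if i \<le> k then
        of_nat (k choose i) * fps_nth (fls_nth ((deriv_eta ^^ (k - i)) (S k)) n) 0 else 0)"
    if "k < Suc m" for k n i
    using Suc.prems(1) that const_coeff_ops_coeff by (intro const_op_mult_t_power) blast
  have "fps_nth (fls_nth (S m) n) 0 = 0" for n
  proof -
    have "0 = (\<Sum>k<Suc m. fps_nth (fls_nth (S k \<odot> eta_monom (fps_X ^ k) 0) n) m)"
      using arg_cong[OF Suc.prems(2), of "\<lambda>H. fps_nth (fls_nth H n) m"]
      by (simp only: fls_nth_sum fps_sum_nth fls_zero_nth fps_zero_nth)
    also have "\<dots> = fps_nth (fls_nth (S m) n) 0" by (simp add: T)
    finally show ?thesis by simp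
  qed
  hence "S m = 0"
    using const_coeff_ops_coeff[OF Suc.prems(1)[of m]]
    by (intro fls_eqI fps_ext) (metis fls_zero_nth fps_zero_nth gr0I lessI)
  with Suc show ?case by (cases "k = m") auto
qed simp

lemma right_form_unique:
  assumes "\<And>k. k < m \<Longrightarrow> S k \<in> const_coeff_ops p absv" "\<And>k. k < m \<Longrightarrow> S' k \<in> const_coeff_ops p absv"
    and "(\<Sum>k<m. S k \<odot> eta_monom (fps_X ^ k) 0) = (\<Sum>k<m. S' k \<odot> eta_monom (fps_X ^ k) 0)"
    and "k < m"
  shows "S k = S' k"
proof -
  have "S k - S' k = 0"
    by (rule right_form_eq_0[of m "\<lambda>k. S k - S' k"])
       (use assms in \<open>auto simp: const_coeff_ops_diff op_mult_diff_left sum_subtractf\<close>)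
  thus ?thesis by simp
qed

end

section \<open>Existence and uniqueness of the division with remainder\<close>

theorem mainTheorem8:
  fixes p :: nat and absv :: "'k::field_char_0 \<Rightarrow> real"
    and F :: "'k fps fls" and m :: nat and b :: "'k fps"
  assumes K: "spherically_complete_padic_field p absv"
    and F: "F \<in> microdiff_ops p absv" "dominant p absv F"
    and b: "b \<in> disc_series absv" "\<exists>c\<in>disc_series absv. b * c = 1"
    and symbol: "principal_symbol F = eta_monom (fps_X ^ m * b) (op_ord F)"
  shows "\<forall>G\<in>microdiff_ops p absv.
    (\<exists>!QR. fst QR \<in> microdiff_ops p absv \<and>
           snd QR \<in> {..<m} \<rightarrow>\<^sub>E const_coeff_ops p absv \<and>
           G = fst QR \<odot> F + (\<Sum>i<m. eta_monom (fps_X ^ i) 0 \<odot> snd QR i)) \<and>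
    (\<forall>Q\<in>microdiff_ops p absv. \<forall>R\<in>{..<m} \<rightarrow>\<^sub>E const_coeff_ops p absv.
       G = Q \<odot> F + (\<Sum>i<m. eta_monom (fps_X ^ i) 0 \<odot> R i) \<longrightarrow>
       (\<exists>!S. S \<in> {..<m} \<rightarrow>\<^sub>E const_coeff_ops p absv \<and>
             (\<Sum>i<m. eta_monom (fps_X ^ i) 0 \<odot> R i) = (\<Sum>i<m. S i \<odot> eta_monom (fps_X ^ i) 0)))"
proof -
  interpret spherically_complete_padic_field p absv by (rule K)
  obtain c where c: "c \<in> disc_series absv" "b * c = 1" using b(2) by blast
  have "b \<noteq> 0" using c(2) by auto
  \<comment> \<open>The order is minus the subdegree, so the symbol is the lowest Laurent
    coefficient.\<close>
  have sym: "fls_nth F (fls_subdegree F) = fps_X ^ m * b"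
    using arg_cong[OF symbol, of "\<lambda>H. eta_coeff H (op_ord F)"]
    by (simp add: principal_symbol_def eta_coeff_eta_monom) (simp add: eta_coeff_def op_ord_def)
  let ?C = "const_coeff_ops p absv"
  let ?L = "\<lambda>R. \<Sum>i<m. eta_monom (fps_X ^ i) 0 \<odot> R i"
  have L_coeff: "fps_nth (fls_nth (?L R) n) i = (if i < m then fps_nth (fls_nth (R i) n) 0 else 0)"
    if "R \<in> {..<m} \<rightarrow>\<^sub>E ?C" for R n i
    using that const_coeff_ops_coeff by (intro fps_nth_t_power_sum) auto
  show ?thesis
  proof (intro ballI conjI impI)
    fix G assume G: "G \<in> microdiff_ops p absv"
    obtain Q where Q: "Q \<in> microdiff_ops p absv" "G - Q \<odot> F \<in> microdiff_ops p absv"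
      "\<And>n i. m \<le> i \<Longrightarrow> fps_nth (fls_nth (G - Q \<odot> F) n) i = 0"
      using division_exists[OF F b(1) c sym G] by blast
    have "\<forall>k. \<exists>R\<in>?C. \<forall>n. fps_nth (fls_nth R n) 0 = fps_nth (fls_nth (G - Q \<odot> F) n) k"
      using const_coeff_ops_of_coeff[OF Q(2)] by blast
    then obtain R where R: "\<And>k. R k \<in> ?C"
      "\<And>k n. fps_nth (fls_nth (R k) n) 0 = fps_nth (fls_nth (G - Q \<odot> F) n) k"
      by metis
    \<comment> \<open>Families are extensional, with value \<open>undefined\<close> from
      \<open>m\<close> on; without this they could not be unique.\<close>
    define R' where "R' = restrict R {..<m}"
    have R': "R' \<in> {..<m} \<rightarrow>\<^sub>E ?C" using R(1) by (auto simp: R'_def)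
    have "G - Q \<odot> F = ?L R'"
      by (rule low_degree_decomposition[OF Q(3)])
         (use R(2) const_coeff_ops_coeff[OF R(1)] in \<open>auto simp: R'_def\<close>)
    hence GQR: "G = Q \<odot> F + ?L R'" by (simp add: algebra_simps)
    show "\<exists>!QR. fst QR \<in> microdiff_ops p absv \<and> snd QR \<in> {..<m} \<rightarrow>\<^sub>E ?C \<and>
           G = fst QR \<odot> F + ?L (snd QR)"
    proof (rule ex1I[of _ "(Q, R')"], goal_cases)
      case 1
      show ?case using Q R' GQR by simp
    next
      case (2 QR)
      define P T where "P = fst QR" and "T = snd QR"
      have T: "T \<in> {..<m} \<rightarrow>\<^sub>E ?C" and G': "G = P \<odot> F + ?L T"
        using 2 by (auto simp: P_def T_def)
      have "(Q - P) \<odot> F = ?L T - ?L R'"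
        using GQR G' by (simp add: op_mult_diff_left algebra_simps)
      \<comment> \<open>A difference of two remainders has degree below \<open>m\<close> in t and is
        a left multiple of \<open>F\<close>.\<close>
      hence "Q - P = 0"
        using L_coeff[OF T] L_coeff[OF R']
        by (intro right_divisor_eq_0[OF sym \<open>b \<noteq> 0\<close>]) simp
      hence "P = Q" by simp
      hence L: "?L T = ?L R'" using GQR G' by simp
      have "T = R'"
      proof (rule PiE_ext[OF T R'])
        fix k assume k: "k \<in> {..<m}"
        show "T k = R' k"
        proof (rule fls_eqI, rule fps_ext)
          fix n i
          have "T k \<in> ?C" "R' k \<in> ?C" using T R' k by auto
          hence "fps_nth (fls_nth (T k) n) i = 0 \<and> fps_nth (fls_nth (R' k) n) i = 0" if "i > 0"
            using that const_coeff_ops_coeff by blast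
          moreover have "fps_nth (fls_nth (T k) n) 0 = fps_nth (fls_nth (R' k) n) 0"
            using L_coeff[OF T, of n k] L_coeff[OF R', of n k] k L by simp
          ultimately show "fps_nth (fls_nth (T k) n) i = fps_nth (fls_nth (R' k) n) i"
            by (cases "i = 0") auto
        qed
      qed
      with \<open>P = Q\<close> show ?case by (auto simp: P_def T_def)
    qed
  next
    fix G Q R assume R: "R \<in> {..<m} \<rightarrow>\<^sub>E ?C"
    have "\<exists>S. (\<forall>k<m. S k \<in> ?C) \<and> ?L R = (\<Sum>i<m. S i \<odot> eta_monom (fps_X ^ i) 0)"
      using R by (intro right_form_exists) auto
    then obtain S where S: "\<And>k. k < m \<Longrightarrow> S k \<in> ?C" "?L R = (\<Sum>i<m. S i \<odot> eta_monom (fps_X ^ i) 0)"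
      by blast
    show "\<exists>!S. S \<in> {..<m} \<rightarrow>\<^sub>E ?C \<and> ?L R = (\<Sum>i<m. S i \<odot> eta_monom (fps_X ^ i) 0)"
    proof (rule ex1I[of _ "restrict S {..<m}"], goal_cases)
      case 1
      show ?case using S by auto
    next
      case (2 T)
      have "T k = S k" if "k < m" for k
        by (rule right_form_unique[of m T S]) (use 2 S that in auto)
      thus ?case using 2 by (intro PiE_ext[of T "{..<m}" "\<lambda>_. ?C"]) (auto simp: S(1))
    qed
  qed
qed

end
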